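(* There exists an $\iota$-chain homotopy $s:\widetilde{\mathcal{W}}\to\widetilde{\mathcal{W}}$ between the two maps of $\iota$-complexes $\mathrm{id}_{\widetilde{\mathcal{W}}}$ and $\chi_{\mathcal{W}}\circ\tau$. That is, there exist linear maps $s^i:\widetilde{\mathcal{W}}^i\to\widetilde{\mathcal{W}}^{i-1}$ and $s^i_\iota:\widetilde{\mathcal{W}}^i_\iota\to\widetilde{\mathcal{W}}^{i-1}_\iota$ such that for all $i$ $$d^{i-1}\circ s^i+s^{i+1}\circ d^i=\mathrm{id}-\chi^i_{\mathcal{W}}\circ\tau^i,\qquad d_\iota^{i-1}\circ s_\iota^i+s_\iota^{i+1}\circ d_\iota^i=\mathrm{id}-\chi^i_{\mathcal{W},\iota}\circ\tau_\iota^i,\qquad s_\iota^{i-1}\circ\iota^i+\iota^{i-1}\circ s^i=0.$$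
   Context: All vector spaces are over $\mathbb{Q}$. **Weil diagrams.** A Weil diagram is a finite graph (possibly empty or disconnected; parallel edges and self-loop edges allowed) whose vertices all have degree 1 (legs) or degree 3, where each trivalent vertex with three distinct incident edges carries a cyclic ordering of these edges (an orientation), the set of legs is totally ordered, and each leg is assigned a grade 1 or 2. Its leg-grade is the sum of the grades of its legs. A Weil diagram with a special vertex is the same except that exactly one degree-1 vertex (the special vertex, labelled $\iota$) is neither ordered nor graded (and is not counted as a leg). Isomorphisms respect all structure. AS relations: $D+D'=0$ if $D'$ is obtained from $D$ by reversing the orientation of one trivalent vertex; and $D=0$ if $D$ has a self-loop edge. IHX relations: $T(a,b|c,e)+T(b,c|a,e)+T(c,a|b,e)=0$, where $T(a,b|c,e)$ denotes a diagram with an edge $f$ joining two trivalent vertices with cyclic orders $(a,b,f)$ and $(f,c,e)$, $a,b,c,e$ being the four other (half-)edges, the three diagrams being identical elsewhere. Perm relations: if $D'$ is obtained from $D$ by exchanging the positions of two adjacent legs of grades $x,y$, then $D=(-1)^{xy}D'$. $\mathcal{W}^i$ (resp. $\mathcal{W}^i_\iota$) is the space of finite linear combinations of isomorphism classes of Weil diagrams (resp. Weil diagrams with a special vertex) of leg-grade $i$, modulo AS, IHX and Perm. $\widetilde{\mathcal{W}}^i$ and $\widetilde{\mathcal{W}}^i_\iota$ are defined in the same way but without the Perm relations (only AS and IHX). All are zero for $i<0$. **Operators.** An operator of grade $j$ given by leg substitution rules sends a diagram with ordered legs $\ell_1<\dots<\ell_n$ of grades $g_1,\dots,g_n$ to $\sum_k(-1)^{j(g_1+\dots+g_{k-1})}D_k$,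 where $D_k$ results from replacing $\ell_k$, in place, according to the rule. The differentials $d,d_\iota$ have grade $+1$: a grade 1 leg is replaced by a grade 2 leg; a grade 2 leg is replaced by $0$. The map $\iota:\widetilde{\mathcal{W}}^i\to\widetilde{\mathcal{W}}^{i-1}_\iota$ (and likewise $\mathcal{W}^i\to\mathcal{W}^{i-1}_\iota$) has grade $-1$: a grade 1 leg is turned into the special vertex; a grade 2 leg is replaced by a trivalent vertex with cyclic order (stem, edge to the special vertex, edge to a new grade 1 leg), the new leg occupying the old position, where the stem is the edge formerly ending at the leg. These make $\mathcal{W}$ and $\widetilde{\mathcal{W}}$ into $\iota$-complexes: $d^2=0$, $d_\iota^2=0$, $\iota^{i+1}d^i=-d_\iota^{i-1}\iota^i$. A map of $\iota$-complexes is a pair of degree-0 sequences of maps commuting with the $d$'s and $\iota$'s. **Maps.** $\chi^i_{\mathcal{W}}:\mathcal{W}^i\to\widetilde{\mathcal{W}}^i$ and $\chi^i_{\mathcal{W},\iota}:\mathcal{W}^i_\iota\to\widetilde{\mathcal{W}}^i_\iota$ are the graded averaging maps: a diagram with $n$ legs is sent to $\frac1{n!}$ times the sum over all reorderings of its legs, each with the sign obtained by writing the reordering as a product of adjacent transpositions, each transposition of legs of grades $x,y$ contributing $(-1)^{xy}$. $\tau^i:\widetilde{\mathcal{W}}^i\to\mathcal{W}^i$ and $\tau^i_\iota:\widetilde{\mathcal{W}}^i_\iota\to\mathcal{W}^i_\iota$ are the canonical quotient maps (imposing the Perm relations). Both are maps of $\iota$-complexes. *)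

theory Defs
  imports
    Complex_Main
    "HOL-Library.Poly_Mapping"
    "HOL-Library.FuncSet"
    "HOL-Combinatorics.Permutations"
begin

section \<open>Weil diagrams\<close>

text \<open>
  A diagram is encoded by its finite set of half-edges. The involution \<open>edge\<close> exchanges the two
  halves of an edge. The vertices are the orbits of \<open>rot\<close>: the fixed points are the vertices of
  degree 1, and an orbit \<open>h, rot h, rot (rot h)\<close> is a trivalent vertex with its cyclic ordering.
  The list \<open>legs\<close> enumerates the legs in their order, each as a pair (half-edge, grade), and
  \<open>special\<close> is the special vertex, if there is one.

  At a trivalent vertex with a self-loop, \<open>rot\<close> chooses one of the two cyclic orderings of the three
  half-edges. Exchanging the two halves of the loop is an isomorphism between the two choices, so
  isomorphism classes of diagrams carry no orientation at such a vertex.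
\<close>

record diagram =
  half_edges :: "nat set"
  edge :: "nat \<Rightarrow> nat"
  rot :: "nat \<Rightarrow> nat"
  legs :: "(nat \<times> nat) list"
  special :: "nat option"

definition weil_diagram :: "diagram \<Rightarrow> bool" where
  "weil_diagram D \<longleftrightarrow>
     finite (half_edges D) \<and>
     (\<forall>h\<in>half_edges D. edge D h \<in> half_edges D \<and> edge D h \<noteq> h \<and> edge D (edge D h) = h) \<and>
     (\<forall>h\<in>half_edges D. rot D h \<in> half_edges D \<and> rot D (rot D (rot D h)) = h) \<and>
     distinct (map fst (legs D)) \<and>
     snd ` set (legs D) \<subseteq> {1, 2} \<and>
     fst ` set (legs D) \<inter> set_option (special D) = {} \<and>
     fst ` set (legs D) \<union> set_option (special D) = {h \<in> half_edges D. rot D h = h}"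

definition leg_grade :: "diagram \<Rightarrow> nat" where
  "leg_grade D = sum_list (map snd (legs D))"

definition is_isomorphism :: "(nat \<Rightarrow> nat) \<Rightarrow> diagram \<Rightarrow> diagram \<Rightarrow> bool" where
  "is_isomorphism \<phi> D D' \<longleftrightarrow>
     bij_betw \<phi> (half_edges D) (half_edges D') \<and>
     (\<forall>h\<in>half_edges D. \<phi> (edge D h) = edge D' (\<phi> h) \<and> \<phi> (rot D h) = rot D' (\<phi> h)) \<and>
     map (map_prod \<phi> id) (legs D) = legs D' \<and>
     map_option \<phi> (special D) = special D'"

definition isomorphic :: "diagram \<Rightarrow> diagram \<Rightarrow> bool" where
  "isomorphic D D' \<longleftrightarrow> weil_diagram D \<and> weil_diagram D' \<and> (\<exists>\<phi>. is_isomorphism \<phi> D D')"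

lemma weil_diagramD:
  assumes "weil_diagram D"
  shows "finite (half_edges D)"
    and "\<And>h. h \<in> half_edges D \<Longrightarrow> edge D h \<in> half_edges D"
    and "\<And>h. h \<in> half_edges D \<Longrightarrow> edge D h \<noteq> h"
    and "\<And>h. h \<in> half_edges D \<Longrightarrow> edge D (edge D h) = h"
    and "\<And>h. h \<in> half_edges D \<Longrightarrow> rot D h \<in> half_edges D"
    and "\<And>h. h \<in> half_edges D \<Longrightarrow> rot D (rot D (rot D h)) = h"
    and "distinct (map fst (legs D))"
    and "snd ` set (legs D) \<subseteq> {1, 2}"
    and "fst ` set (legs D) \<inter> set_option (special D) = {}"
    and "fst ` set (legs D) \<union> set_option (special D) = {h \<in> half_edges D. rot D h = h}"
  using assms unfolding weil_diagram_def by simp_all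

lemma weil_diagram_legD:
  assumes "weil_diagram D" "k < length (legs D)"
  shows "fst (legs D ! k) \<in> half_edges D"
    and "rot D (fst (legs D ! k)) = fst (legs D ! k)"
    and "snd (legs D ! k) = 1 \<or> snd (legs D ! k) = 2"
    and "fst (legs D ! k) \<notin> set_option (special D)"
proof -
  have m: "legs D ! k \<in> set (legs D)"
    using assms(2) by simp
  then have "fst (legs D ! k) \<in> {h \<in> half_edges D. rot D h = h}"
    using weil_diagramD(10)[OF assms(1)] by blast
  then show "fst (legs D ! k) \<in> half_edges D" "rot D (fst (legs D ! k)) = fst (legs D ! k)"
    by auto
  show "snd (legs D ! k) = 1 \<or> snd (legs D ! k) = 2"
    using weil_diagramD(8)[OF assms(1)] m by blast
  show "fst (legs D ! k) \<notin> set_option (special D)"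
    using weil_diagramD(9)[OF assms(1)] m by blast
qed

lemma is_isomorphism_id: "is_isomorphism id D D"
  by (simp add: is_isomorphism_def map_prod.id option.map_id)

lemma is_isomorphism_compose:
  assumes "is_isomorphism \<phi> D D'" "is_isomorphism \<psi> D' D''"
  shows "is_isomorphism (\<psi> \<circ> \<phi>) D D''"
proof -
  have "map (map_prod (\<psi> \<circ> \<phi>) id) (legs D) = map (map_prod \<psi> id) (map (map_prod \<phi> id) (legs D))"
    by (auto simp: map_prod_def)
  moreover have "map_option (\<psi> \<circ> \<phi>) (special D) = map_option \<psi> (map_option \<phi> (special D))"
    by (simp add: option.map_comp)
  ultimately show ?thesis
    using assms unfolding is_isomorphism_def by (auto intro: bij_betw_trans simp: bij_betwE)
qed

lemma is_isomorphism_inverse: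
  assumes D: "weil_diagram D" and \<phi>: "is_isomorphism \<phi> D D'"
  shows "is_isomorphism (inv_into (half_edges D) \<phi>) D' D"
proof -
  let ?\<psi> = "inv_into (half_edges D) \<phi>"
  have b: "bij_betw \<phi> (half_edges D) (half_edges D')"
    using \<phi> by (simp add: is_isomorphism_def)
  have l: "?\<psi> (\<phi> h) = h" if "h \<in> half_edges D" for h
    using b that by (simp add: bij_betw_inv_into_left)
  have 1: "?\<psi> (edge D' h) = edge D (?\<psi> h) \<and> ?\<psi> (rot D' h) = rot D (?\<psi> h)"
    if h: "h \<in> half_edges D'" for h
  proof -
    obtain g where g: "g \<in> half_edges D" "h = \<phi> g"
      using b h by (auto simp: bij_betw_def)
    then have "edge D' h = \<phi> (edge D g)" "rot D' h = \<phi> (rot D g)"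
      using \<phi> by (auto simp: is_isomorphism_def)
    then show ?thesis
      using l g weil_diagramD(2,5)[OF D] by simp
  qed
  have 2: "map (map_prod ?\<psi> id) (map (map_prod \<phi> id) (legs D)) = legs D"
  proof -
    have "fst p \<in> half_edges D" if "p \<in> set (legs D)" for p
      using that weil_diagramD(10)[OF D] by blast
    then show ?thesis
      by (auto simp: l intro!: map_idI)
  qed
  have "special D = Some h \<Longrightarrow> h \<in> half_edges D" for h
    using weil_diagramD(10)[OF D] by auto
  then have 3: "map_option ?\<psi> (map_option \<phi> (special D)) = special D"
    using l by (cases "special D") auto
  show ?thesis
    using \<phi> 1 2 3 bij_betw_inv_into[OF b] unfolding is_isomorphism_def by auto
qed

definition empty_diagram :: diagram where
  "empty_diagram = \<lparr>half_edges = {}, edge = id, rot = id, legs = [], special = None\<rparr>"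

quotient_type diagram_class = diagram / partial: isomorphic
proof (rule part_equivpI)
  have "weil_diagram empty_diagram"
    by (simp add: weil_diagram_def empty_diagram_def)
  then show "\<exists>D. isomorphic D D"
    using is_isomorphism_id isomorphic_def by blast
  show "symp isomorphic"
    by (rule sympI) (auto simp: isomorphic_def dest: is_isomorphism_inverse)
  show "transp isomorphic"
    by (rule transpI) (auto simp: isomorphic_def dest: is_isomorphism_compose)
qed

abbreviation iso_class :: "diagram \<Rightarrow> diagram_class" where
  "iso_class \<equiv> abs_diagram_class"

lemma iso_class_eq: "isomorphic D D' \<Longrightarrow> iso_class D = iso_class D'"
  using Quotient3_rel_abs[OF Quotient3_diagram_class] .

lemma isomorphic_refl: "weil_diagram D \<Longrightarrow> isomorphic D D"
  using is_isomorphism_id isomorphic_def by blast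

section \<open>Linear combinations of diagrams\<close>

type_synonym diagram_comb = "diagram_class \<Rightarrow>\<^sub>0 rat"

definition comb_scale :: "rat \<Rightarrow> diagram_comb \<Rightarrow> diagram_comb" where
  "comb_scale c = Poly_Mapping.map ((*) c)"

lemma lookup_comb_scale [simp]: "Poly_Mapping.lookup (comb_scale c v) x = c * Poly_Mapping.lookup v x"
  by (simp add: comb_scale_def Poly_Mapping.map.rep_eq when_def)

interpretation comb: vector_space comb_scale
  by standard (auto intro!: poly_mapping_eqI simp: lookup_add algebra_simps)

definition diagram_vec :: "diagram \<Rightarrow> diagram_comb" where
  "diagram_vec D = Poly_Mapping.single (iso_class D) 1"

definition linear_extension :: "(diagram_class \<Rightarrow> diagram_comb) \<Rightarrow> diagram_comb \<Rightarrow> diagram_comb" where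
  "linear_extension g v = (\<Sum>x\<in>Poly_Mapping.keys v. comb_scale (Poly_Mapping.lookup v x) (g x))"

lemma linear_extension_superset:
  assumes "finite A" "Poly_Mapping.keys v \<subseteq> A"
  shows "linear_extension g v = (\<Sum>x\<in>A. comb_scale (Poly_Mapping.lookup v x) (g x))"
  unfolding linear_extension_def
  by (rule sum.mono_neutral_left) (use assms in \<open>auto simp: in_keys_iff\<close>)

lemma linear_extension_add:
  "linear_extension g (v + w) = linear_extension g v + linear_extension g w"
proof -
  let ?A = "Poly_Mapping.keys v \<union> Poly_Mapping.keys w"
  have "Poly_Mapping.keys (v + w) \<subseteq> ?A"
    by (rule keys_add)
  then show ?thesis
    by (simp add: linear_extension_superset[of ?A] lookup_add comb.scale_left_distrib sum.distrib)
qed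

lemma linear_extension_scale:
  "linear_extension g (comb_scale c v) = comb_scale c (linear_extension g v)"
proof -
  have "Poly_Mapping.keys (comb_scale c v) \<subseteq> Poly_Mapping.keys v"
    by (auto simp: in_keys_iff)
  then show ?thesis
    by (simp add: linear_extension_superset[of "Poly_Mapping.keys v"] comb.scale_sum_right)
qed

lemma linear_linear_extension: "Vector_Spaces.linear comb_scale comb_scale (linear_extension g)"
  by standard (simp_all add: linear_extension_add linear_extension_scale)

lemma linear_extension_diff:
  "linear_extension g (v - w) = linear_extension g v - linear_extension g w"
proof -
  interpret Vector_Spaces.linear comb_scale comb_scale "linear_extension g"
    by (rule linear_linear_extension)
  show ?thesis
    by (rule diff)
qed

lemma linear_extension_sum:
  "linear_extension g (sum f A) = (\<Sum>a\<in>A. linear_extension g (f a))"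
proof -
  interpret Vector_Spaces.linear comb_scale comb_scale "linear_extension g"
    by (rule linear_linear_extension)
  show ?thesis
    by (rule sum)
qed

lemma linear_extension_vec: "linear_extension g (diagram_vec D) = g (iso_class D)"
  by (simp add: linear_extension_def diagram_vec_def)

section \<open>The relations\<close>

text \<open>The orientation reversed at the trivalent vertex containing \<open>v\<close>.\<close>

definition reversed_rot :: "(nat \<Rightarrow> nat) \<Rightarrow> nat \<Rightarrow> nat \<Rightarrow> nat" where
  "reversed_rot r v = r(v := r (r v), r (r v) := r v, r v := v)"

text \<open>
  The two halves of a self-loop belong to one trivalent vertex, so one of them is followed by the
  other in its cyclic ordering.
\<close>

definition AS_relators :: "diagram_comb set" where
  "AS_relators =
     {diagram_vec D + diagram_vec (D\<lparr>rot := reversed_rot (rot D) v\<rparr>) | D v.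
        weil_diagram D \<and> v \<in> half_edges D \<and> rot D v \<noteq> v} \<union>
     {diagram_vec D | D. weil_diagram D \<and> (\<exists>h\<in>half_edges D. edge D h = rot D h)}"

text \<open>
  The cyclic orders \<open>(a, b, f)\<close> and \<open>(f', c, e)\<close> at the two ends of an edge with halves \<open>f\<close>, \<open>f'\<close>.
  All six are half-edges, so \<open>a\<close>, \<open>b\<close>, \<open>c\<close>, \<open>e\<close> may belong to fewer than four edges.
\<close>

definition IHX_rot :: "(nat \<Rightarrow> nat) \<Rightarrow> nat \<Rightarrow> nat \<Rightarrow> nat \<Rightarrow> nat \<Rightarrow> nat \<Rightarrow> nat \<Rightarrow> nat \<Rightarrow> nat" where
  "IHX_rot r f f' a b c e = r(a := b, b := f, f := a, f' := c, c := e, e := f')"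

definition IHX_relators :: "diagram_comb set" where
  "IHX_relators =
     {diagram_vec (D\<lparr>rot := IHX_rot (rot D) f f' a b c e\<rparr>) +
      diagram_vec (D\<lparr>rot := IHX_rot (rot D) f f' b c a e\<rparr>) +
      diagram_vec (D\<lparr>rot := IHX_rot (rot D) f f' c a b e\<rparr>) | D f f' a b c e.
        weil_diagram D \<and> f \<in> half_edges D \<and> f' = edge D f \<and>
        rot D a = b \<and> rot D b = f \<and> rot D f = a \<and>
        rot D f' = c \<and> rot D c = e \<and> rot D e = f' \<and>
        distinct [a, b, f, f', c, e]}"

definition swap_adjacent :: "nat \<Rightarrow> 'a list \<Rightarrow> 'a list" where
  "swap_adjacent k xs = xs[k := xs ! Suc k, Suc k := xs ! k]"

definition Perm_relators :: "diagram_comb set" where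
  "Perm_relators =
     {diagram_vec D -
      comb_scale ((-1) ^ (snd (legs D ! k) * snd (legs D ! Suc k)))
        (diagram_vec (D\<lparr>legs := swap_adjacent k (legs D)\<rparr>)) | D k.
        weil_diagram D \<and> Suc k < length (legs D)}"

definition tilde_relations :: "diagram_comb set" where
  "tilde_relations = comb.span (AS_relators \<union> IHX_relators)"

definition weil_relations :: "diagram_comb set" where
  "weil_relations = comb.span (AS_relators \<union> IHX_relators \<union> Perm_relators)"

section \<open>The quotient spaces\<close>

text \<open>
  \<open>weil_tilde\<close> is the direct sum of all the spaces without Perm relations, of all leg-grades and both
  with and without a special vertex; \<open>weil\<close> is its analogue with Perm relations. Every relator only
  involves diagrams of one leg-grade, either all with or all without a special vertex, so that each
  summand is the image in the quotient of the span of its diagrams.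
\<close>

lemma equivp_mod_subspace:
  assumes "comb.subspace R"
  shows "equivp (\<lambda>v w. v - w \<in> R)"
proof (rule equivpI)
  show "reflp (\<lambda>v w. v - w \<in> R)"
    by (rule reflpI) (simp add: comb.subspace_0[OF assms])
  show "symp (\<lambda>v w. v - w \<in> R)"
  proof (rule sympI)
    fix v w
    assume "v - w \<in> R"
    then have "- (v - w) \<in> R"
      by (rule comb.subspace_neg[OF assms])
    then show "w - v \<in> R"
      by simp
  qed
  show "transp (\<lambda>v w. v - w \<in> R)"
  proof (rule transpI)
    fix u v w
    assume "u - v \<in> R" "v - w \<in> R"
    then have "(u - v) + (v - w) \<in> R"
      by (rule comb.subspace_add[OF assms])
    then show "u - w \<in> R"
      by simp
  qed
qed

lemma subspace_relations [simp]:
  "comb.subspace tilde_relations" "comb.subspace weil_relations"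
  by (simp_all add: tilde_relations_def weil_relations_def)

lemma zero_in_relations [simp]: "0 \<in> tilde_relations" "0 \<in> weil_relations"
  by (simp_all add: comb.subspace_0)

quotient_type weil_tilde = diagram_comb / "\<lambda>v w. v - w \<in> tilde_relations"
  by (rule equivp_mod_subspace) simp

quotient_type weil = diagram_comb / "\<lambda>v w. v - w \<in> weil_relations"
  by (rule equivp_mod_subspace) simp

lemma mod_subspace_add:
  assumes "comb.subspace R" "v - v' \<in> R" "w - w' \<in> R"
  shows "(v + w) - (v' + w') \<in> R"
  using comb.subspace_add[OF assms] by (simp add: algebra_simps)

lemma mod_subspace_diff:
  assumes "comb.subspace R" "v - v' \<in> R" "w - w' \<in> R"
  shows "(v - w) - (v' - w') \<in> R"
  using comb.subspace_diff[OF assms] by (simp add: algebra_simps)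

lemma mod_subspace_uminus:
  assumes "comb.subspace R" "v - v' \<in> R"
  shows "(- v) - (- v') \<in> R"
  using comb.subspace_neg[OF assms] by simp

lemma mod_subspace_scale:
  assumes "comb.subspace R" "v - v' \<in> R"
  shows "comb_scale c v - comb_scale c v' \<in> R"
  using comb.subspace_scale[OF assms] by (simp add: comb.scale_right_diff_distrib)

instantiation weil_tilde :: ab_group_add
begin
lift_definition zero_weil_tilde :: weil_tilde is 0 .
lift_definition plus_weil_tilde :: "weil_tilde \<Rightarrow> weil_tilde \<Rightarrow> weil_tilde" is "(+)"
  by (rule mod_subspace_add) simp_all
lift_definition minus_weil_tilde :: "weil_tilde \<Rightarrow> weil_tilde \<Rightarrow> weil_tilde" is "(-)"
  by (rule mod_subspace_diff) simp_all
lift_definition uminus_weil_tilde :: "weil_tilde \<Rightarrow> weil_tilde" is uminus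
  by (rule mod_subspace_uminus) simp_all
instance
proof
  fix a b c :: weil_tilde
  show "a + b + c = a + (b + c)"
    by transfer (simp add: add.assoc)
  show "a + b = b + a"
    by transfer (simp add: add.commute)
  show "0 + a = a"
    by transfer simp
  show "- a + a = 0"
    by transfer simp
  show "a - b = a + - b"
    by transfer simp
qed
end

instantiation weil :: ab_group_add
begin
lift_definition zero_weil :: weil is 0 .
lift_definition plus_weil :: "weil \<Rightarrow> weil \<Rightarrow> weil" is "(+)"
  by (rule mod_subspace_add) simp_all
lift_definition minus_weil :: "weil \<Rightarrow> weil \<Rightarrow> weil" is "(-)"
  by (rule mod_subspace_diff) simp_all
lift_definition uminus_weil :: "weil \<Rightarrow> weil" is uminus
  by (rule mod_subspace_uminus) simp_all
instance
proof
  fix a b c :: weil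
  show "a + b + c = a + (b + c)"
    by transfer (simp add: add.assoc)
  show "a + b = b + a"
    by transfer (simp add: add.commute)
  show "0 + a = a"
    by transfer simp
  show "- a + a = 0"
    by transfer simp
  show "a - b = a + - b"
    by transfer simp
qed
end

lift_definition tilde_scale :: "rat \<Rightarrow> weil_tilde \<Rightarrow> weil_tilde" is comb_scale
  by (rule mod_subspace_scale) simp_all

lift_definition weil_scale :: "rat \<Rightarrow> weil \<Rightarrow> weil" is comb_scale
  by (rule mod_subspace_scale) simp_all

interpretation weil_tilde: vector_space tilde_scale
proof
  fix a b :: rat and x y :: weil_tilde
  show "tilde_scale a (x + y) = tilde_scale a x + tilde_scale a y"
    by transfer (simp add: comb.scale_right_distrib)
  show "tilde_scale (a + b) x = tilde_scale a x + tilde_scale b x"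
    by transfer (simp add: comb.scale_left_distrib)
  show "tilde_scale a (tilde_scale b x) = tilde_scale (a * b) x"
    by transfer simp
  show "tilde_scale 1 x = x"
    by transfer simp
qed

interpretation weil: vector_space weil_scale
proof
  fix a b :: rat and x y :: weil
  show "weil_scale a (x + y) = weil_scale a x + weil_scale a y"
    by transfer (simp add: comb.scale_right_distrib)
  show "weil_scale (a + b) x = weil_scale a x + weil_scale b x"
    by transfer (simp add: comb.scale_left_distrib)
  show "weil_scale a (weil_scale b x) = weil_scale (a * b) x"
    by transfer simp
  show "weil_scale 1 x = x"
    by transfer simp
qed

definition tilde_grade :: "int \<Rightarrow> weil_tilde set" where
  "tilde_grade i = abs_weil_tilde `
     comb.span {diagram_vec D | D. weil_diagram D \<and> special D = None \<and> int (leg_grade D) = i}"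

definition tilde_iota_grade :: "int \<Rightarrow> weil_tilde set" where
  "tilde_iota_grade i = abs_weil_tilde `
     comb.span {diagram_vec D | D. weil_diagram D \<and> special D \<noteq> None \<and> int (leg_grade D) = i}"

definition linear_between :: "weil_tilde set \<Rightarrow> weil_tilde set \<Rightarrow> (weil_tilde \<Rightarrow> weil_tilde) \<Rightarrow> bool" where
  "linear_between U V f \<longleftrightarrow>
     f \<in> U \<rightarrow> V \<and>
     (\<forall>x\<in>U. \<forall>y\<in>U. f (x + y) = f x + f y) \<and>
     (\<forall>c. \<forall>x\<in>U. f (tilde_scale c x) = tilde_scale c (f x))"


section \<open>The operators on diagrams\<close>

definition prefix_sign :: "diagram \<Rightarrow> nat \<Rightarrow> rat" where
  "prefix_sign D k = (-1) ^ sum_list (take k (map snd (legs D)))"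

definition differential_diagram :: "diagram \<Rightarrow> diagram_comb" where
  "differential_diagram D =
     (\<Sum>k<length (legs D).
        if snd (legs D ! k) = 1
        then comb_scale (prefix_sign D k)
               (diagram_vec (D\<lparr>legs := (legs D)[k := (fst (legs D ! k), 2)]\<rparr>))
        else 0)"

definition fresh_half_edge :: "diagram \<Rightarrow> nat" where
  "fresh_half_edge D = Suc (Max (insert 0 (half_edges D)))"

text \<open>
  In the case of grade 2, \<open>h\<close> becomes the half-edge of the stem at the new trivalent vertex, whose
  cyclic order is \<open>(h, m, m + 2)\<close>; the new edges are \<open>{m, m + 1}\<close>, ending at the special vertex, and
  \<open>{m + 2, m + 3}\<close>, ending at the new leg.
\<close>

definition iota_leg :: "diagram \<Rightarrow> nat \<Rightarrow> diagram" where
  "iota_leg D k =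
     (let h = fst (legs D ! k); m = fresh_half_edge D in
      if snd (legs D ! k) = 1
      then D\<lparr>legs := take k (legs D) @ drop (Suc k) (legs D), special := Some h\<rparr>
      else D\<lparr>half_edges := half_edges D \<union> {m, m + 1, m + 2, m + 3},
             edge := (edge D)(m := m + 1, m + 1 := m, m + 2 := m + 3, m + 3 := m + 2),
             rot := (rot D)(h := m, m := m + 2, m + 2 := h, m + 1 := m + 1, m + 3 := m + 3),
             legs := (legs D)[k := (m + 3, 1)],
             special := Some (m + 1)\<rparr>)"

text \<open>
  The grade of \<open>\<iota>\<close> is \<open>-1\<close>, of the same parity as that of the differentials, so the signs are
  the same. On diagrams that already have a special vertex \<open>\<iota>\<close> is irrelevant, and set to 0.
\<close>

definition iota_diagram :: "diagram \<Rightarrow> diagram_comb" where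
  "iota_diagram D =
     (if special D = None
      then \<Sum>k<length (legs D). comb_scale (prefix_sign D k) (diagram_vec (iota_leg D k))
      else 0)"

text \<open>
  The sign of the reordering that puts at position \<open>i\<close> the leg formerly at position \<open>\<pi> i\<close>. By
  \<open>koszul_sign_id\<close> and \<open>koszul_sign_step\<close> below it is the product of the signs of the steps in
  any decomposition of the reordering into exchanges of adjacent legs.
\<close>

definition koszul_sign :: "nat list \<Rightarrow> (nat \<Rightarrow> nat) \<Rightarrow> rat" where
  "koszul_sign gs \<pi> =
     (\<Prod>(i, j)\<in>{(i, j). i < j \<and> j < length gs \<and> \<pi> j < \<pi> i}. (-1) ^ (gs ! \<pi> i * gs ! \<pi> j))"

definition average_diagram :: "diagram \<Rightarrow> diagram_comb" where
  "average_diagram D =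
     (\<Sum>\<pi> | \<pi> permutes {..<length (legs D)}.
        comb_scale (koszul_sign (map snd (legs D)) \<pi> / fact (length (legs D)))
          (diagram_vec (D\<lparr>legs := permute_list \<pi> (legs D)\<rparr>)))"

lemma koszul_sign_id: "koszul_sign gs id = 1"
proof -
  have "{(i, j). i < j \<and> j < length gs \<and> id j < id i} = {}"
    by auto
  then show ?thesis
    unfolding koszul_sign_def by (simp only: prod.empty)
qed

lemma koszul_sign_alt:
  "koszul_sign gs \<pi> =
     (\<Prod>(i, j)\<in>{(i, j). i < j \<and> j < length gs}.
        if \<pi> j < \<pi> i then (-1) ^ (gs ! \<pi> i * gs ! \<pi> j) else 1)"
proof -
  have f: "finite {(i, j). i < j \<and> j < length gs}"
    by (rule finite_subset[of _ "{..<length gs} \<times> {..<length gs}"]) auto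
  have "{p \<in> {(i, j). i < j \<and> j < length gs}. \<pi> (snd p) < \<pi> (fst p)} =
      {(i, j). i < j \<and> j < length gs \<and> \<pi> j < \<pi> i}"
    by auto
  then show ?thesis
    using prod.inter_filter[OF f, of "\<lambda>p. (-1) ^ (gs ! \<pi> (fst p) * gs ! \<pi> (snd p)) :: rat"
        "\<lambda>p. \<pi> (snd p) < \<pi> (fst p)"]
    unfolding koszul_sign_def by (simp add: case_prod_unfold)
qed

lemma swap_adjacent_conv_permute_list:
  assumes "Suc k < length xs"
  shows "swap_adjacent k xs = permute_list (transpose k (Suc k)) xs"
  using assms
  by (intro nth_equalityI) (auto simp: swap_adjacent_def permute_list_def nth_list_update transpose_def)

lemma koszul_sign_step:
  assumes k: "Suc k < length gs" and \<pi>: "\<pi> permutes {..<length gs}"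
  shows "koszul_sign gs \<pi> =
    (-1) ^ (gs ! k * gs ! Suc k) * koszul_sign (swap_adjacent k gs) (transpose k (Suc k) \<circ> \<pi>)"
proof -
  define t where "t = transpose k (Suc k)"
  define n where "n = length gs"
  define P where "P = {(i :: nat, j). i < j \<and> j < n}"
  define gs' where "gs' = swap_adjacent k gs"
  have len: "length gs' = n"
    by (simp add: gs'_def n_def swap_adjacent_def)
  have t: "t permutes {..<n}"
    unfolding t_def n_def by (rule permutes_swap_id) (use k in auto)
  have nth: "gs' ! t (\<pi> i) = gs ! \<pi> i" if "i < n" for i
  proof -
    have "\<pi> i < n"
      using permutes_in_image[OF \<pi>] that by (simp add: n_def)
    then have "t (\<pi> i) < n"
      using permutes_in_image[OF t] by simp
    moreover have "gs' = permute_list t gs"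
      using k by (simp add: gs'_def t_def swap_adjacent_conv_permute_list)
    ultimately show ?thesis
      by (simp add: permute_list_def n_def t_def)
  qed
  have finP: "finite P"
    unfolding P_def by (rule finite_subset[of _ "{..<n} \<times> {..<n}"]) auto
  define F where "F = (\<lambda>p. if \<pi> (snd p) < \<pi> (fst p)
      then (-1) ^ (gs ! \<pi> (fst p) * gs ! \<pi> (snd p)) else 1 :: rat)"
  define F' where "F' = (\<lambda>p. if t (\<pi> (snd p)) < t (\<pi> (fst p))
      then (-1) ^ (gs ! \<pi> (fst p) * gs ! \<pi> (snd p)) else 1 :: rat)"
  have 1: "koszul_sign gs \<pi> = prod F P"
    by (simp add: koszul_sign_alt F_def P_def n_def case_prod_unfold)
  have 2: "koszul_sign gs' (t \<circ> \<pi>) = prod F' P"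
    unfolding koszul_sign_alt F'_def P_def len
    by (intro prod.cong) (auto simp: nth)
  obtain i where i: "i < n" "\<pi> i = k"
    using permutes_image[OF \<pi>] k by (metis imageE lessThan_iff Suc_lessD n_def)
  obtain j where j: "j < n" "\<pi> j = Suc k"
    using permutes_image[OF \<pi>] k by (metis imageE lessThan_iff n_def)
  have inj: "inj \<pi>"
    using \<pi> by (rule permutes_inj)
  define p where "p = (min i j, max i j)"
  have ne: "i \<noteq> j"
    using i j by auto
  have p: "p \<in> P"
    using i j ne by (auto simp: p_def P_def min_def max_def)
  have other: "F' q = F q" if q: "q \<in> P - {p}" for q
  proof -
    obtain a b where ab: "q = (a, b)" "a < b" "b < n"
      using q by (auto simp: P_def)
    have "\<pi> a = k \<longleftrightarrow> a = i" "\<pi> b = k \<longleftrightarrow> b = i" "\<pi> a = Suc k \<longleftrightarrow> a = j" "\<pi> b = Suc k \<longleftrightarrow> b = j"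
      using inj_eq[OF inj] i j by metis+
    then have "\<not> (\<pi> a = k \<and> \<pi> b = Suc k)" "\<not> (\<pi> a = Suc k \<and> \<pi> b = k)"
      using q ab by (auto simp: p_def)
    moreover have "\<pi> a \<noteq> \<pi> b"
      using inj_eq[OF inj] ab by simp
    ultimately have "t (\<pi> b) < t (\<pi> a) \<longleftrightarrow> \<pi> b < \<pi> a"
      unfolding t_def transpose_def by auto
    then show ?thesis
      by (simp add: F_def F'_def ab)
  qed
  have sq: "(-1) ^ m * (-1) ^ m = (1 :: rat)" for m :: nat
    by (simp flip: power_mult_distrib)
  have same: "F p = (-1) ^ (gs ! k * gs ! Suc k) * F' p"
  proof (cases "i < j")
    case True
    then have "p = (i, j)"
      by (simp add: p_def)
    then show ?thesis
      using i j by (simp add: F_def F'_def t_def sq)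
  next
    case False
    then have "p = (j, i)"
      using ne by (simp add: p_def)
    then show ?thesis
      using i j by (simp add: F_def F'_def t_def mult.commute)
  qed
  have "prod F P = F p * prod F (P - {p})"
    using finP p by (rule prod.remove)
  also have "\<dots> = (-1) ^ (gs ! k * gs ! Suc k) * (F' p * prod F' (P - {p}))"
    unfolding same using prod.cong[OF refl other, of "P - {p}" "\<lambda>q. q"] by (simp add: mult.assoc)
  also have "F' p * prod F' (P - {p}) = prod F' P"
    using finP p by (rule prod.remove[symmetric])
  finally show ?thesis
    using 1 2 by (simp add: gs'_def t_def)
qed

subsection \<open>Invariance under isomorphism\<close>

lemma map_prod_id_legs: "map snd (map (map_prod \<phi> id) ls) = map snd ls"
  by simp

lemma is_isomorphismD:
  assumes "is_isomorphism \<phi> D D'"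
  shows "bij_betw \<phi> (half_edges D) (half_edges D')"
    and "\<And>h. h \<in> half_edges D \<Longrightarrow> edge D' (\<phi> h) = \<phi> (edge D h)"
    and "\<And>h. h \<in> half_edges D \<Longrightarrow> rot D' (\<phi> h) = \<phi> (rot D h)"
    and "legs D' = map (map_prod \<phi> id) (legs D)"
    and "special D' = map_option \<phi> (special D)"
  using assms unfolding is_isomorphism_def by simp_all

lemma weil_diagram_isomorphism:
  assumes D: "weil_diagram D" and \<phi>: "is_isomorphism \<phi> D D'"
  shows "weil_diagram D'"
proof -
  note \<phi>D = is_isomorphismD[OF \<phi>] and DD = weil_diagramD[OF D]
  have inj: "inj_on \<phi> (half_edges D)" and im: "half_edges D' = \<phi> ` half_edges D"
    using \<phi>D(1) by (auto simp: bij_betw_def)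
  have L: "fst ` set (legs D) \<subseteq> half_edges D" and S: "set_option (special D) \<subseteq> half_edges D"
    using DD(10) by auto
  have L': "fst ` set (legs D') = \<phi> ` fst ` set (legs D)"
    by (simp add: \<phi>D(4) image_image)
  have S': "set_option (special D') = \<phi> ` set_option (special D)"
    by (simp add: \<phi>D(5) option.set_map)
  have mf: "map fst (legs D') = map \<phi> (map fst (legs D))"
    by (simp add: \<phi>D(4))
  show ?thesis
    unfolding weil_diagram_def
  proof (intro conjI)
    show "finite (half_edges D')"
      using DD(1) im by simp
    show "\<forall>h\<in>half_edges D'. edge D' h \<in> half_edges D' \<and> edge D' h \<noteq> h \<and> edge D' (edge D' h) = h"
      using DD(2-4) \<phi>D(2) inj im by (auto dest: inj_onD)
    show "\<forall>h\<in>half_edges D'. rot D' h \<in> half_edges D' \<and> rot D' (rot D' (rot D' h)) = h"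
      using DD(5,6) \<phi>D(3) im by auto
    show "distinct (map fst (legs D'))"
      unfolding mf using DD(7) inj_on_subset[OF inj L]
      by (subst distinct_map) simp
    show "snd ` set (legs D') \<subseteq> {1, 2}"
      using DD(8) by (simp add: \<phi>D(4) image_image)
    show "fst ` set (legs D') \<inter> set_option (special D') = {}"
      using DD(9) L S inj unfolding L' S' by (simp add: inj_on_image_Int[symmetric])
    have "{h \<in> half_edges D'. rot D' h = h} = \<phi> ` {h \<in> half_edges D. rot D h = h}"
      using inj_on_eq_iff[OF inj] DD(5) by (auto simp: im \<phi>D(3))
    then show "fst ` set (legs D') \<union> set_option (special D') = {h \<in> half_edges D'. rot D' h = h}"
      using DD(10) unfolding L' S' by (metis image_Un)
  qed
qed

lemma isomorphic_legs:
  assumes "weil_diagram (D\<lparr>legs := ls\<rparr>)" "is_isomorphism \<phi> D D'"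
  shows "isomorphic (D\<lparr>legs := ls\<rparr>) (D'\<lparr>legs := map (map_prod \<phi> id) ls\<rparr>)"
proof -
  have "is_isomorphism \<phi> (D\<lparr>legs := ls\<rparr>) (D'\<lparr>legs := map (map_prod \<phi> id) ls\<rparr>)"
    using assms(2) by (simp add: is_isomorphism_def)
  then show ?thesis
    using assms(1) weil_diagram_isomorphism by (auto simp: isomorphic_def)
qed

lemma diagram_vec_eq: "isomorphic D D' \<Longrightarrow> diagram_vec D = diagram_vec D'"
  by (simp add: diagram_vec_def iso_class_eq)

lemma weil_diagram_regrade:
  assumes "weil_diagram D" "k < length (legs D)"
  shows "weil_diagram (D\<lparr>legs := (legs D)[k := (fst (legs D ! k), 2)]\<rparr>)"
proof -
  let ?ls = "(legs D)[k := (fst (legs D ! k), 2)]"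
  have 1: "map fst ?ls = map fst (legs D)"
    by (simp add: map_update flip: nth_map[OF assms(2)])
  have 2: "snd ` set ?ls \<subseteq> {1, 2}"
    using weil_diagramD(8)[OF assms(1)] set_update_subset_insert[of "legs D" k] by fastforce
  have "fst ` set ?ls = fst ` set (legs D)"
    using arg_cong[OF 1, of set] by (simp only: set_map)
  then show ?thesis
    using assms(1) 1 2 by (simp add: weil_diagram_def)
qed

lemma weil_diagram_permute:
  assumes "weil_diagram D" "\<pi> permutes {..<length (legs D)}"
  shows "weil_diagram (D\<lparr>legs := permute_list \<pi> (legs D)\<rparr>)"
proof -
  have "mset (map fst (permute_list \<pi> (legs D))) = mset (map fst (legs D))"
    using assms(2) by simp
  then have "distinct (map fst (permute_list \<pi> (legs D)))"
    using weil_diagramD(7)[OF assms(1)] mset_eq_imp_distinct_iff by blast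
  moreover have "set (permute_list \<pi> (legs D)) = set (legs D)"
    using assms(2) by simp
  ultimately show ?thesis
    using assms(1) by (simp add: weil_diagram_def)
qed

lemma isomorphic_prefix_sign:
  "is_isomorphism \<phi> D D' \<Longrightarrow> prefix_sign D' k = prefix_sign D k"
  using is_isomorphismD(4) map_prod_id_legs by (simp add: prefix_sign_def)

lemma differential_diagram_iso:
  assumes "isomorphic D D'"
  shows "differential_diagram D = differential_diagram D'"
proof -
  obtain \<phi> where D: "weil_diagram D" and \<phi>: "is_isomorphism \<phi> D D'"
    using assms by (auto simp: isomorphic_def)
  note legs' = is_isomorphismD(4)[OF \<phi>]
  show ?thesis
    unfolding differential_diagram_def
  proof (rule sum.cong, simp add: legs', rule if_cong)
    fix k
    assume "k \<in> {..<length (legs D')}"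
    then have k: "k < length (legs D)"
      by (simp add: legs')
    then show "snd (legs D ! k) = 1 \<longleftrightarrow> snd (legs D' ! k) = 1"
      by (simp add: legs')
    have "map (map_prod \<phi> id) ((legs D)[k := (fst (legs D ! k), 2)]) =
        (legs D')[k := (fst (legs D' ! k), 2)]"
      using k by (simp add: legs' map_update)
    then show "comb_scale (prefix_sign D k)
          (diagram_vec (D\<lparr>legs := (legs D)[k := (fst (legs D ! k), 2)]\<rparr>)) =
        comb_scale (prefix_sign D' k)
          (diagram_vec (D'\<lparr>legs := (legs D')[k := (fst (legs D' ! k), 2)]\<rparr>))"
      using diagram_vec_eq[OF isomorphic_legs[OF weil_diagram_regrade[OF D k] \<phi>]]
      by (simp add: isomorphic_prefix_sign[OF \<phi>])
  qed simp
qed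

lemma average_diagram_iso:
  assumes "isomorphic D D'"
  shows "average_diagram D = average_diagram D'"
proof -
  obtain \<phi> where D: "weil_diagram D" and \<phi>: "is_isomorphism \<phi> D D'"
    using assms by (auto simp: isomorphic_def)
  note legs' = is_isomorphismD(4)[OF \<phi>]
  have len: "length (legs D') = length (legs D)" and snds: "map snd (legs D') = map snd (legs D)"
    by (simp_all add: legs' map_prod_id_legs)
  have "diagram_vec (D\<lparr>legs := permute_list \<pi> (legs D)\<rparr>) =
      diagram_vec (D'\<lparr>legs := permute_list \<pi> (legs D')\<rparr>)"
    if "\<pi> permutes {..<length (legs D)}" for \<pi>
    using diagram_vec_eq[OF isomorphic_legs[OF weil_diagram_permute[OF D that] \<phi>]] that
    by (simp add: legs' permute_list_map)
  then show ?thesis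
    unfolding average_diagram_def len snds by (intro sum.cong) auto
qed

lemma less_fresh_half_edge:
  "weil_diagram D \<Longrightarrow> h \<in> half_edges D \<Longrightarrow> h < fresh_half_edge D"
  using Max_ge[of "insert 0 (half_edges D)" h] weil_diagramD(1)[of D]
  by (simp add: fresh_half_edge_def less_Suc_eq_le)

lemma iota_leg_1:
  assumes "snd (legs D ! k) = 1"
  shows "iota_leg D k =
    D\<lparr>legs := take k (legs D) @ drop (Suc k) (legs D), special := Some (fst (legs D ! k))\<rparr>"
  using assms by (simp add: iota_leg_def Let_def)

lemma iota_leg_2:
  assumes "snd (legs D ! k) = 2" "h = fst (legs D ! k)" "m = fresh_half_edge D"
  shows "iota_leg D k =
    D\<lparr>half_edges := half_edges D \<union> {m, m + 1, m + 2, m + 3},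
      edge := (edge D)(m := m + 1, m + 1 := m, m + 2 := m + 3, m + 3 := m + 2),
      rot := (rot D)(h := m, m := m + 2, m + 2 := h, m + 1 := m + 1, m + 3 := m + 3),
      legs := (legs D)[k := (m + 3, 1)],
      special := Some (m + 1)\<rparr>"
  using assms by (simp add: iota_leg_def Let_def)

lemma fresh_half_edge_notin:
  assumes "weil_diagram D" "m = fresh_half_edge D"
  shows "m \<notin> half_edges D" "m + 1 \<notin> half_edges D" "m + 2 \<notin> half_edges D" "m + 3 \<notin> half_edges D"
  using less_fresh_half_edge[OF assms(1)] unfolding assms(2) by fastforce+

lemma legs_split:
  assumes "k < length ls"
  shows "ls = take k ls @ ls ! k # drop (Suc k) ls"
  using assms by (simp add: id_take_nth_drop)

lemma weil_diagram_iota_leg: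
  assumes D: "weil_diagram D" and s: "special D = None" and k: "k < length (legs D)"
  shows "weil_diagram (iota_leg D k)"
proof -
  note DD = weil_diagramD[OF D] and kD = weil_diagram_legD[OF D k]
  define h where "h = fst (legs D ! k)"
  define A where "A = take k (legs D) @ drop (Suc k) (legs D)"
  have setL: "set (legs D) = insert (legs D ! k) (set A)"
    by (subst legs_split[OF k]) (simp add: A_def)
  have "distinct (map fst (take k (legs D) @ legs D ! k # drop (Suc k) (legs D)))"
    using DD(7) legs_split[OF k] by simp
  then have dA: "distinct (map fst A)" and hA: "h \<notin> fst ` set A"
    by (auto simp: A_def h_def)
  have "insert h (fst ` set A) = {g \<in> half_edges D. rot D g = g}"
    using DD(10) s setL by (simp add: h_def)
  then have fA: "fst ` set A = {g \<in> half_edges D. rot D g = g} - {h}"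
    using hA by blast
  show ?thesis
  proof (cases "snd (legs D ! k) = 1")
    case True
    have "weil_diagram (D\<lparr>legs := A, special := Some h\<rparr>)"
      using D dA hA fA setL DD(8) kD(1,2) by (auto simp: weil_diagram_def h_def)
    then show ?thesis
      using True by (simp add: iota_leg_1 A_def h_def)
  next
    case False
    then have g: "snd (legs D ! k) = 2"
      using kD(3) by simp
    define m where "m = fresh_half_edge D"
    have lt: "g < m" if "g \<in> half_edges D" for g
      using less_fresh_half_edge[OF D that] by (simp add: m_def)
    have hH: "h \<in> half_edges D" and hr: "rot D h = h"
      using kD by (simp_all add: h_def)
    have upd: "(legs D)[k := (m + 3, 1)] = take k (legs D) @ (m + 3, 1) # drop (Suc k) (legs D)"
      using k by (simp add: upd_conv_take_nth_drop)
    have set': "set ((legs D)[k := (m + 3, 1)]) = insert (m + 3, 1) (set A)"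
      unfolding upd by (simp add: A_def)
    note new = fresh_half_edge_notin[OF D m_def]
    define E where "E = iota_leg D k"
    note E_eq = E_def[unfolded iota_leg_2[OF g h_def m_def]]
    have E_sel: "half_edges E = half_edges D \<union> {m, m + 1, m + 2, m + 3}"
      "legs E = (legs D)[k := (m + 3, 1)]" "special E = Some (m + 1)"
      "edge E m = m + 1" "edge E (m + 1) = m" "edge E (m + 2) = m + 3" "edge E (m + 3) = m + 2"
      "rot E m = m + 2" "rot E (m + 2) = h" "rot E (m + 1) = m + 1" "rot E (m + 3) = m + 3"
      using hH new by (auto simp: E_eq)
    have e_old: "edge E g = edge D g" if "g \<in> half_edges D" for g
      using new that by (auto simp: E_eq)
    have r_h: "rot E h = m"
      using new hH by (auto simp: E_eq)
    have r_old: "rot E g = rot D g" if "g \<in> half_edges D" "g \<noteq> h" for g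
      using new that by (auto simp: E_eq)
    have r_ne: "rot D g \<noteq> h" if "g \<in> half_edges D" "g \<noteq> h" for g
      using that DD(6)[of g] hr by metis
    have c1: "finite (half_edges E)"
      using DD(1) by (simp add: E_sel(1))
    have c2: "\<forall>g\<in>half_edges E. edge E g \<in> half_edges E \<and> edge E g \<noteq> g \<and> edge E (edge E g) = g"
      using DD(2-4) by (auto simp: E_sel E_sel[simplified] e_old)
    have c3: "\<forall>g\<in>half_edges E. rot E g \<in> half_edges E \<and> rot E (rot E (rot E g)) = g"
    proof
      fix g
      assume "g \<in> half_edges E"
      then consider "g \<in> half_edges D" "g \<noteq> h" | "g \<in> {h, m, m + 2}" | "g \<in> {m + 1, m + 3}"
        unfolding E_sel(1) by blast
      then show "rot E g \<in> half_edges E \<and> rot E (rot E (rot E g)) = g"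
      proof cases
        case 1
        then have "rot E g = rot D g" "rot E (rot D g) = rot D (rot D g)"
          "rot E (rot D (rot D g)) = rot D (rot D (rot D g))"
          using r_old r_ne DD(5) by presburger+
        then show ?thesis
          using 1 DD(5,6) unfolding E_sel(1) by simp
      next
        case 2
        then show ?thesis
          unfolding E_sel(1) using E_sel(8,9) r_h hH by fastforce
      next
        case 3
        then show ?thesis
          unfolding E_sel(1) using E_sel(10,11) by fastforce
      qed
    qed
    have c4: "distinct (map fst (legs E))"
      unfolding E_sel(2) upd using dA new(4) fA by (auto simp: A_def)
    have c5: "snd ` set (legs E) \<subseteq> {1, 2}"
      unfolding E_sel(2) set' using DD(8) setL by auto
    have c6: "fst ` set (legs E) \<inter> set_option (special E) = {}"
      unfolding E_sel(2,3) set' using fA new by auto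
    have c7: "fst ` set (legs E) \<union> set_option (special E) = {g \<in> half_edges E. rot E g = g}"
    proof -
      have L: "fst ` set (legs E) \<union> set_option (special E) =
          {m + 3, m + 1} \<union> ({g \<in> half_edges D. rot D g = g} - {h})"
        unfolding E_sel(2,3) set' fA[symmetric] by auto
      have 1: "{g \<in> {m, m + 1, m + 2, m + 3}. rot E g = g} = {m + 3, m + 1}"
      proof (rule set_eqI)
        fix g
        show "g \<in> {g \<in> {m, m + 1, m + 2, m + 3}. rot E g = g} \<longleftrightarrow> g \<in> {m + 3, m + 1}"
          using E_sel(8-11) E_sel(8-11)[simplified] new hH by auto
      qed
      have 2: "{g \<in> half_edges D. rot E g = g} = {g \<in> half_edges D. rot D g = g} - {h}"
      proof (rule set_eqI)
        fix g
        show "g \<in> {g \<in> half_edges D. rot E g = g} \<longleftrightarrow> g \<in> {g \<in> half_edges D. rot D g = g} - {h}"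
          using r_old[of g] r_h new(1) by (cases "g = h") auto
      qed
      have "{g \<in> half_edges E. rot E g = g} =
          {g \<in> {m, m + 1, m + 2, m + 3}. rot E g = g} \<union> {g \<in> half_edges D. rot E g = g}"
        unfolding E_sel(1) by blast
      then show ?thesis
        unfolding L 1 2 by (rule sym)
    qed
    show ?thesis
      unfolding E_def[symmetric] weil_diagram_def by (intro conjI c1 c2 c3 c4 c5 c6 c7)
  qed
qed

lemma isomorphic_iota_leg:
  assumes D: "weil_diagram D" and \<phi>: "is_isomorphism \<phi> D D'" and s: "special D = None"
    and k: "k < length (legs D)"
  shows "isomorphic (iota_leg D k) (iota_leg D' k)"
proof -
  note \<phi>D = is_isomorphismD[OF \<phi>] and DD = weil_diagramD[OF D] and kD = weil_diagram_legD[OF D k]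
  have D': "weil_diagram D'"
    using weil_diagram_isomorphism[OF D \<phi>] .
  have s': "special D' = None" and k': "k < length (legs D')"
    using s k by (simp_all add: \<phi>D)
  have leg': "legs D' ! k = map_prod \<phi> id (legs D ! k)"
    using k by (simp add: \<phi>D(4))
  have "\<exists>\<psi>. is_isomorphism \<psi> (iota_leg D k) (iota_leg D' k)"
  proof (cases "snd (legs D ! k) = 1")
    case True
    have "is_isomorphism \<phi> (iota_leg D k) (iota_leg D' k)"
      using \<phi> True leg' by (simp add: is_isomorphism_def iota_leg_1 \<phi>D(4) take_map drop_map)
    then show ?thesis
      by blast
  next
    case False
    then have g: "snd (legs D ! k) = 2" and g': "snd (legs D' ! k) = 2"
      using kD(3) leg' by simp_all
    define h h' where "h = fst (legs D ! k)" and "h' = fst (legs D' ! k)"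
    have hh: "h' = \<phi> h" "h \<in> half_edges D"
      using leg' kD(1) by (simp_all add: h_def h'_def)
    define m m' where "m = fresh_half_edge D" and "m' = fresh_half_edge D'"
    note sel = iota_leg_2[OF g h_def m_def] and sel' = iota_leg_2[OF g' h'_def m'_def]
    have lt: "g < m" if "g \<in> half_edges D" for g
      using less_fresh_half_edge[OF D that] by (simp add: m_def)
    have lt': "g < m'" if "g \<in> half_edges D'" for g
      using less_fresh_half_edge[OF D' that] by (simp add: m'_def)
    define \<psi> where "\<psi> = (\<lambda>g. if g < m then \<phi> g else g - m + m')"
    have \<psi>old: "\<psi> g = \<phi> g" if "g \<in> half_edges D" for g
      using lt[OF that] by (simp add: \<psi>_def)
    have \<psi>new: "\<psi> m = m'" "\<psi> (m + 1) = m' + 1" "\<psi> (m + 2) = m' + 2" "\<psi> (m + 3) = m' + 3"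
      by (simp_all add: \<psi>_def)
    have \<phi>H: "\<phi> g \<in> half_edges D'" if "g \<in> half_edges D" for g
      using \<phi>D(1) that by (auto simp: bij_betw_def)
    have "bij_betw \<psi> (half_edges D \<union> {m, m + 1, m + 2, m + 3})
        (half_edges D' \<union> {m', m' + 1, m' + 2, m' + 3})"
    proof (rule bij_betw_combine)
      show "bij_betw \<psi> (half_edges D) (half_edges D')"
        using \<phi>D(1) \<psi>old by (simp cong: bij_betw_cong)
      show "bij_betw \<psi> {m, m + 1, m + 2, m + 3} {m', m' + 1, m' + 2, m' + 3}"
        using \<psi>new by (auto simp: bij_betw_def inj_on_def)
      show "half_edges D' \<inter> {m', m' + 1, m' + 2, m' + 3} = {}"
        using lt' by fastforce
    qed
    moreover have "map (map_prod \<psi> id) ((legs D)[k := (m + 3, 1)]) = (legs D')[k := (m' + 3, 1)]"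
    proof -
      have "map (map_prod \<psi> id) (legs D) = legs D'"
        unfolding \<phi>D(4)
      proof (rule map_cong[OF refl])
        fix p
        assume "p \<in> set (legs D)"
        then have "fst p \<in> half_edges D"
          using DD(10) by blast
        then show "map_prod \<psi> id p = map_prod \<phi> id p"
          by (cases p) (simp add: \<psi>old)
      qed
      then show ?thesis
        by (simp add: map_update \<psi>new)
    qed
    moreover have "\<psi> (edge (iota_leg D k) g) = edge (iota_leg D' k) (\<psi> g) \<and>
        \<psi> (rot (iota_leg D k) g) = rot (iota_leg D' k) (\<psi> g)"
      if g: "g \<in> half_edges D \<union> {m, m + 1, m + 2, m + 3}" for g
    proof (cases "g \<in> half_edges D")
      case True
      have "g \<notin> {m, m + 1, m + 2, m + 3}"
        using fresh_half_edge_notin[OF D m_def] True by auto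
      moreover have "\<phi> g \<notin> {m', m' + 1, m' + 2, m' + 3}"
        using fresh_half_edge_notin[OF D' m'_def] \<phi>H[OF True] by auto
      moreover have "\<phi> g = \<phi> h \<longleftrightarrow> g = h"
        using \<phi>D(1) True hh(2) by (auto simp: bij_betw_def dest: inj_onD)
      ultimately show ?thesis
        unfolding sel sel' using True DD(2,5) \<phi>D(2,3) \<psi>old \<psi>new hh(1) by simp
    next
      case False
      have n: "m \<noteq> h" "m + 1 \<noteq> h" "m + 2 \<noteq> h" "m + 3 \<noteq> h"
        using fresh_half_edge_notin[OF D m_def] hh(2) by auto
      have n': "m' \<noteq> h'" "m' + 1 \<noteq> h'" "m' + 2 \<noteq> h'" "m' + 3 \<noteq> h'"
        using fresh_half_edge_notin[OF D' m'_def] hh \<phi>H by auto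
      have \<psi>h: "\<psi> h = h'"
        using \<psi>old[OF hh(2)] hh(1) by simp
      from False g consider "g = m" | "g = m + 1" | "g = m + 2" | "g = m + 3"
        by blast
      then show ?thesis
        unfolding sel sel' using n n' \<psi>new \<psi>h by cases simp_all
    qed
    ultimately have "is_isomorphism \<psi> (iota_leg D k) (iota_leg D' k)"
      unfolding is_isomorphism_def sel sel' using \<psi>new(2)
      by (simp del: Un_insert_right fun_upd_apply)
    then show ?thesis
      by blast
  qed
  then show ?thesis
    using weil_diagram_iota_leg[OF D s k] weil_diagram_iota_leg[OF D' s' k']
    by (simp add: isomorphic_def)
qed

lemma iota_diagram_iso:
  assumes "isomorphic D D'"
  shows "iota_diagram D = iota_diagram D'"
proof -
  obtain \<phi> where D: "weil_diagram D" and \<phi>: "is_isomorphism \<phi> D D'"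
    using assms by (auto simp: isomorphic_def)
  note \<phi>D = is_isomorphismD[OF \<phi>]
  have "diagram_vec (iota_leg D k) = diagram_vec (iota_leg D' k)"
    if "special D = None" "k < length (legs D)" for k
    using diagram_vec_eq[OF isomorphic_iota_leg[OF D \<phi> that]] .
  then show ?thesis
    unfolding iota_diagram_def isomorphic_prefix_sign[OF \<phi>] using \<phi>D(4,5)
    by (auto intro!: sum.cong)
qed

lift_definition differential_class :: "diagram_class \<Rightarrow> diagram_comb" is differential_diagram
  by (rule differential_diagram_iso)

lift_definition iota_class :: "diagram_class \<Rightarrow> diagram_comb" is iota_diagram
  by (rule iota_diagram_iso)

lift_definition average_class :: "diagram_class \<Rightarrow> diagram_comb" is average_diagram
  by (rule average_diagram_iso)

subsection \<open>Compatibility with the relations\<close>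

definition rot_relation :: "diagram \<Rightarrow> (nat \<Rightarrow> nat) list \<Rightarrow> bool" where
  "rot_relation D rs \<longleftrightarrow>
     (\<exists>v. v \<in> half_edges D \<and> rot D v \<noteq> v \<and> rs = [rot D, reversed_rot (rot D) v]) \<or>
     (\<exists>h\<in>half_edges D. edge D h = rot D h \<and> rs = [rot D]) \<or>
     (\<exists>f f' a b c e. f \<in> half_edges D \<and> f' = edge D f \<and>
        rot D a = b \<and> rot D b = f \<and> rot D f = a \<and>
        rot D f' = c \<and> rot D c = e \<and> rot D e = f' \<and> distinct [a, b, f, f', c, e] \<and>
        rs = [IHX_rot (rot D) f f' a b c e, IHX_rot (rot D) f f' b c a e,
          IHX_rot (rot D) f f' c a b e])"

lemma rot_relation_cases [consumes 1, case_names AS loop IHX]: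
  assumes "rot_relation D rs"
  obtains v where "v \<in> half_edges D" "rot D v \<noteq> v" "rs = [rot D, reversed_rot (rot D) v]"
  | h where "h \<in> half_edges D" "edge D h = rot D h" "rs = [rot D]"
  | f f' a b c e where "f \<in> half_edges D" "f' = edge D f"
      "rot D a = b" "rot D b = f" "rot D f = a" "rot D f' = c" "rot D c = e" "rot D e = f'"
      "distinct [a, b, f, f', c, e]"
      "rs = [IHX_rot (rot D) f f' a b c e, IHX_rot (rot D) f f' b c a e,
          IHX_rot (rot D) f f' c a b e]"
  using assms unfolding rot_relation_def by blast

lemma rot_relationI:
  shows "v \<in> half_edges D \<Longrightarrow> rot D v \<noteq> v \<Longrightarrow> rs = [rot D, reversed_rot (rot D) v] \<Longrightarrow>
      rot_relation D rs"
    and "h \<in> half_edges D \<Longrightarrow> edge D h = rot D h \<Longrightarrow> rs = [rot D] \<Longrightarrow> rot_relation D rs"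
    and "f \<in> half_edges D \<Longrightarrow> f' = edge D f \<Longrightarrow>
      rot D a = b \<Longrightarrow> rot D b = f \<Longrightarrow> rot D f = a \<Longrightarrow>
      rot D f' = c \<Longrightarrow> rot D c = e \<Longrightarrow> rot D e = f' \<Longrightarrow> distinct [a, b, f, f', c, e] \<Longrightarrow>
      rs = [IHX_rot (rot D) f f' a b c e, IHX_rot (rot D) f f' b c a e,
          IHX_rot (rot D) f f' c a b e] \<Longrightarrow> rot_relation D rs"
  unfolding rot_relation_def by blast+

definition rot_relator :: "diagram \<Rightarrow> (nat \<Rightarrow> nat) list \<Rightarrow> diagram_comb" where
  "rot_relator D rs = (\<Sum>r\<leftarrow>rs. diagram_vec (D\<lparr>rot := r\<rparr>))"

lemma rot_update_same [simp]: "D\<lparr>rot := rot D\<rparr> = (D :: diagram)"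
  by simp

lemma rot_legs_update: "D\<lparr>rot := r, legs := ls\<rparr> = D\<lparr>legs := ls, rot := r\<rparr>" for D :: diagram
  by simp

lemma AS_IHX_relators:
  "AS_relators \<union> IHX_relators = {rot_relator D rs | D rs. weil_diagram D \<and> rot_relation D rs}"
    (is "?L = ?R")
proof (rule subset_antisym; rule subsetI)
  fix x
  assume "x \<in> ?L"
  then consider (1) D v where "weil_diagram D" "v \<in> half_edges D" "rot D v \<noteq> v"
      "x = diagram_vec D + diagram_vec (D\<lparr>rot := reversed_rot (rot D) v\<rparr>)"
    | (2) D h where "weil_diagram D" "h \<in> half_edges D" "edge D h = rot D h" "x = diagram_vec D"
    | (3) D f f' a b c e where "weil_diagram D" "f \<in> half_edges D" "f' = edge D f"
      "rot D a = b" "rot D b = f" "rot D f = a" "rot D f' = c" "rot D c = e" "rot D e = f'"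
      "distinct [a, b, f, f', c, e]"
      "x = diagram_vec (D\<lparr>rot := IHX_rot (rot D) f f' a b c e\<rparr>) +
        diagram_vec (D\<lparr>rot := IHX_rot (rot D) f f' b c a e\<rparr>) +
        diagram_vec (D\<lparr>rot := IHX_rot (rot D) f f' c a b e\<rparr>)"
    unfolding AS_relators_def IHX_relators_def by blast
  then show "x \<in> ?R"
  proof cases
    case 1
    then have "rot_relation D [rot D, reversed_rot (rot D) v]"
      unfolding rot_relation_def by blast
    moreover have "x = rot_relator D [rot D, reversed_rot (rot D) v]"
      using 1 by (simp add: rot_relator_def)
    ultimately show ?thesis
      using 1 by blast
  next
    case 2
    then have "rot_relation D [rot D]"
      unfolding rot_relation_def by blast
    moreover have "x = rot_relator D [rot D]"
      using 2 by (simp add: rot_relator_def)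
    ultimately show ?thesis
      using 2 by blast
  next
    case 3
    let ?rs = "[IHX_rot (rot D) f f' a b c e, IHX_rot (rot D) f f' b c a e,
          IHX_rot (rot D) f f' c a b e]"
    have "rot_relation D ?rs"
      unfolding rot_relation_def using 3 by blast
    moreover have "x = rot_relator D ?rs"
      unfolding rot_relator_def using 3(11) by (simp add: add.assoc)
    ultimately show ?thesis
      using 3(1) by blast
  qed
next
  fix x
  assume "x \<in> ?R"
  then obtain D rs where D: "weil_diagram D" "rot_relation D rs" and x: "x = rot_relator D rs"
    by blast
  from D(2) show "x \<in> ?L"
  proof (cases rule: rot_relation_cases)
    case (AS v)
    then have "x = diagram_vec D + diagram_vec (D\<lparr>rot := reversed_rot (rot D) v\<rparr>)"
      by (simp add: x rot_relator_def)
    then show ?thesis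
      using D AS unfolding AS_relators_def by blast
  next
    case (loop h)
    then have "x = diagram_vec D"
      by (simp add: x rot_relator_def)
    then show ?thesis
      using D loop unfolding AS_relators_def by blast
  next
    case (IHX f f' a b c e)
    have "x = diagram_vec (D\<lparr>rot := IHX_rot (rot D) f f' a b c e\<rparr>) +
        diagram_vec (D\<lparr>rot := IHX_rot (rot D) f f' b c a e\<rparr>) +
        diagram_vec (D\<lparr>rot := IHX_rot (rot D) f f' c a b e\<rparr>)"
      unfolding x rot_relator_def IHX(10) by (simp add: add.assoc)
    then show ?thesis
      using D IHX(1-9) unfolding IHX_relators_def by blast
  qed
qed

lemma rot_relator_in_relations:
  assumes "weil_diagram D" "rot_relation D rs"
  shows "rot_relator D rs \<in> tilde_relations"
  unfolding tilde_relations_def AS_IHX_relators by (rule comb.span_base) (use assms in blast)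

lemma rot_relation_legs:
  assumes "rot_relation D rs"
  shows "rot_relation (D\<lparr>legs := ls\<rparr>) rs" "rot_relation (D\<lparr>special := s\<rparr>) rs"
  using assms unfolding rot_relation_def by simp_all

lemma weil_diagram_rot:
  assumes D: "weil_diagram D"
    and r: "\<And>h. h \<in> half_edges D \<Longrightarrow> r h \<in> half_edges D \<and> r (r (r h)) = h"
    and fixed: "\<And>h. h \<in> half_edges D \<Longrightarrow> r h = h \<longleftrightarrow> rot D h = h"
  shows "weil_diagram (D\<lparr>rot := r\<rparr>)"
proof -
  have "{h \<in> half_edges D. r h = h} = {h \<in> half_edges D. rot D h = h}"
    using fixed by blast
  then show ?thesis
    using D r unfolding weil_diagram_def by simp
qed

lemma rot_inj:
  assumes "weil_diagram D" "g \<in> half_edges D" "h \<in> half_edges D" "rot D g = rot D h"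
  shows "g = h"
  using assms weil_diagramD(6) by metis

lemma weil_diagram_reversed_rot:
  assumes D: "weil_diagram D" and v: "v \<in> half_edges D" "rot D v \<noteq> v"
  shows "weil_diagram (D\<lparr>rot := reversed_rot (rot D) v\<rparr>)"
proof -
  note DD = weil_diagramD[OF D]
  define p q where "p = rot D v" and "q = rot D p"
  have pq: "p \<in> half_edges D" "q \<in> half_edges D" "rot D q = v"
    using v DD(5,6) by (simp_all add: p_def q_def)
  have ne: "v \<noteq> p" "p \<noteq> q" "v \<noteq> q"
    using v pq DD(6)[of v] by (auto simp: p_def q_def)
  let ?r = "reversed_rot (rot D) v"
  have r: "?r v = q" "?r q = p" "?r p = v"
    using ne by (auto simp: reversed_rot_def p_def q_def)
  have other: "?r h = rot D h" "rot D h \<notin> {v, p, q}" if "h \<in> half_edges D" "h \<notin> {v, p, q}" for h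
  proof -
    show "?r h = rot D h"
      using that by (simp add: reversed_rot_def p_def q_def)
    show "rot D h \<notin> {v, p, q}"
      using that rot_inj[OF D that(1), of q] rot_inj[OF D that(1), of v] rot_inj[OF D that(1), of p]
        v(1) pq by (auto simp: p_def q_def)
  qed
  show ?thesis
  proof (rule weil_diagram_rot[OF D])
    fix h
    assume h: "h \<in> half_edges D"
    show "?r h \<in> half_edges D \<and> ?r (?r (?r h)) = h"
    proof (cases "h \<in> {v, p, q}")
      case True
      then show ?thesis
        using r v pq by auto
    next
      case False
      have "?r (rot D h) = rot D (rot D h)" "?r (rot D (rot D h)) = h"
        using other[OF h False] other[OF _ other(2)[OF h False]] DD(5)[OF h] DD(5)[OF DD(5)[OF h]]
          DD(6)[OF h] other(1)[of "rot D (rot D h)"] by auto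
      then show ?thesis
        using other(1)[OF h False] DD(5)[OF h] by simp
    qed
    show "?r h = h \<longleftrightarrow> rot D h = h"
    proof (cases "h \<in> {v, p, q}")
      case True
      then show ?thesis
        using r ne pq by (auto simp: p_def q_def)
    next
      case False
      then show ?thesis
        using other(1)[OF h] by simp
    qed
  qed
qed

lemma weil_diagram_IHX_rot:
  assumes D: "weil_diagram D" and d: "distinct [a, b, f, f', c, e]"
    and H: "{a, b, f, f', c, e} \<subseteq> half_edges D"
    and im: "rot D ` {a, b, f, f', c, e} \<subseteq> {a, b, f, f', c, e}"
    and ne: "\<And>h. h \<in> {a, b, f, f', c, e} \<Longrightarrow> rot D h \<noteq> h"
  shows "weil_diagram (D\<lparr>rot := IHX_rot (rot D) f f' a b c e\<rparr>)"
proof -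
  note DD = weil_diagramD[OF D]
  let ?S = "{a, b, f, f', c, e}"
  let ?r = "IHX_rot (rot D) f f' a b c e"
  have r: "?r a = b" "?r b = f" "?r f = a" "?r f' = c" "?r c = e" "?r e = f'"
    using d by (auto simp: IHX_rot_def)
  have inj: "inj_on (rot D) (half_edges D)"
    using rot_inj[OF D] by (auto intro: inj_onI)
  have surj: "rot D ` ?S = ?S"
    by (rule card_subset_eq) (use im card_image[OF inj_on_subset[OF inj H]] in auto)
  have other: "?r h = rot D h" "rot D h \<notin> ?S" if "h \<in> half_edges D" "h \<notin> ?S" for h
  proof -
    show "?r h = rot D h"
      using that by (simp add: IHX_rot_def)
    show "rot D h \<notin> ?S"
    proof
      assume "rot D h \<in> ?S"
      then obtain g where "g \<in> ?S" "rot D h = rot D g"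
        using surj by (metis imageE)
      then show False
        using that inj_onD[OF inj, of h g] H by auto
    qed
  qed
  show ?thesis
  proof (rule weil_diagram_rot[OF D])
    fix h
    assume h: "h \<in> half_edges D"
    show "?r h \<in> half_edges D \<and> ?r (?r (?r h)) = h"
    proof (cases "h \<in> ?S")
      case True
      then show ?thesis
        using r H by auto
    next
      case False
      note 1 = other[OF h False]
      note 2 = other[OF DD(5)[OF h] 1(2)]
      note 3 = other[OF DD(5)[OF DD(5)[OF h]] 2(2)]
      show ?thesis
        using 1 2 3 DD(5,6)[OF h] by metis
    qed
    show "?r h = h \<longleftrightarrow> rot D h = h"
    proof (cases "h \<in> ?S")
      case True
      then show ?thesis
        using r d ne[OF True] by auto
    next
      case False
      then show ?thesis
        using other(1)[OF h] by simp
    qed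
  qed
qed

lemma weil_diagram_rot_relation:
  assumes D: "weil_diagram D" and "rot_relation D rs" "r \<in> set rs"
  shows "weil_diagram (D\<lparr>rot := r\<rparr>)"
  using assms(2)
proof (cases rule: rot_relation_cases)
  case (AS v)
  then show ?thesis
    using D weil_diagram_reversed_rot assms(3) by auto
next
  case loop
  then show ?thesis
    using D assms(3) by simp
next
  case (IHX f f' a b c e)
  have "f' \<in> half_edges D" "a \<in> half_edges D" "c \<in> half_edges D"
    using IHX(1,2,5,6) weil_diagramD(2,5)[OF D] by blast+
  moreover from this have "b \<in> half_edges D" "e \<in> half_edges D"
    using IHX(3,7) weil_diagramD(5)[OF D] by blast+
  ultimately have H: "{a, b, f, f', c, e} \<subseteq> half_edges D"
    using IHX(1) by blast
  have im: "rot D ` {a, b, f, f', c, e} \<subseteq> {a, b, f, f', c, e}"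
    using IHX(3-8) by auto
  have ne: "rot D h \<noteq> h" if "h \<in> {a, b, f, f', c, e}" for h
    using IHX(3-9) that by auto
  have perm: "{b, c, f, f', a, e} = {a, b, f, f', c, e}" "{c, a, f, f', b, e} = {a, b, f, f', c, e}"
    by blast+
  have d: "distinct [b, c, f, f', a, e]" "distinct [c, a, f, f', b, e]"
    using IHX(9) by auto
  note 1 = weil_diagram_IHX_rot[OF D IHX(9) H im ne]
  note 2 = weil_diagram_IHX_rot[OF D d(1), unfolded perm, OF H im ne]
  note 3 = weil_diagram_IHX_rot[OF D d(2), unfolded perm, OF H im ne]
  from assms(3) show ?thesis
    unfolding IHX(10) using 1 2 3 by auto
qed

lemma sum_list_sum_swap:
  "(\<Sum>x\<leftarrow>xs. \<Sum>a\<in>A. f x a) = (\<Sum>a\<in>A. \<Sum>x\<leftarrow>xs. f x a :: 'b :: comm_monoid_add)"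
  by (induction xs) (simp_all add: sum.distrib)

lemma comb_scale_sum_list: "comb_scale c (sum_list vs) = (\<Sum>v\<leftarrow>vs. comb_scale c v)"
  by (induction vs) (simp_all add: comb.scale_right_distrib)

lemma linear_extension_sum_list:
  "linear_extension g (sum_list vs) = (\<Sum>v\<leftarrow>vs. linear_extension g v)"
  by (induction vs) (simp_all add: linear_extension_add, simp add: linear_extension_def)

lemma linear_extension_span:
  assumes "\<And>x. x \<in> B \<Longrightarrow> linear_extension g x \<in> S" "comb.subspace S" "v \<in> comb.span B"
  shows "linear_extension g v \<in> S"
proof -
  interpret L: Vector_Spaces.linear comb_scale comb_scale "linear_extension g"
    by (rule linear_linear_extension)
  have "linear_extension g ` B \<subseteq> S"
    using assms(1) by blast
  then have "comb.span (linear_extension g ` B) \<subseteq> S"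
    using assms(2) by (rule comb.span_minimal)
  then show ?thesis
    using assms(3) L.span_image by blast
qed

lemma linear_extension_rot_relator:
  assumes "weil_diagram D" "rot_relation D rs" "\<And>D. weil_diagram D \<Longrightarrow> gc (iso_class D) = g D"
  shows "linear_extension gc (rot_relator D rs) = (\<Sum>r\<leftarrow>rs. g (D\<lparr>rot := r\<rparr>))"
proof -
  have "linear_extension gc (diagram_vec (D\<lparr>rot := r\<rparr>)) = g (D\<lparr>rot := r\<rparr>)" if "r \<in> set rs" for r
    using weil_diagram_rot_relation[OF assms(1,2) that] by (simp add: linear_extension_vec assms(3))
  then show ?thesis
    unfolding rot_relator_def linear_extension_sum_list
    by (simp add: o_def cong: map_cong)
qed

lemma class_of_diagram:
  assumes "weil_diagram D"
  shows "differential_class (iso_class D) = differential_diagram D"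
    and "iota_class (iso_class D) = iota_diagram D"
    and "average_class (iso_class D) = average_diagram D"
  using isomorphic_refl[OF assms]
  by (simp_all add: differential_class.abs_eq iota_class.abs_eq average_class.abs_eq)

lemma differential_rot_relator:
  assumes D: "weil_diagram D" and rs: "rot_relation D rs"
  shows "linear_extension differential_class (rot_relator D rs) \<in> tilde_relations"
proof -
  have "linear_extension differential_class (rot_relator D rs) =
      (\<Sum>r\<leftarrow>rs. differential_diagram (D\<lparr>rot := r\<rparr>))"
    by (rule linear_extension_rot_relator[OF D rs, where g = differential_diagram]) (rule class_of_diagram)
  also have "\<dots> = (\<Sum>k<length (legs D). if snd (legs D ! k) = 1
      then comb_scale (prefix_sign D k)
        (rot_relator (D\<lparr>legs := (legs D)[k := (fst (legs D ! k), 2)]\<rparr>) rs)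
      else 0)"
    unfolding differential_diagram_def rot_relator_def
    by (simp add: sum_list_sum_swap comb_scale_sum_list o_def prefix_sign_def rot_legs_update
        if_distrib[of "\<lambda>f. sum_list (map f rs)"] cong: if_cong)
      (intro sum.cong refl, simp)
  also have "\<dots> \<in> tilde_relations"
  proof (intro comb.subspace_sum subspace_relations)
    fix k
    assume "k \<in> {..<length (legs D)}"
    then show "(if snd (legs D ! k) = 1
      then comb_scale (prefix_sign D k)
        (rot_relator (D\<lparr>legs := (legs D)[k := (fst (legs D ! k), 2)]\<rparr>) rs)
      else 0) \<in> tilde_relations"
      using rot_relator_in_relations[OF weil_diagram_regrade[OF D] rot_relation_legs(1)[OF rs]]
      by (auto intro: comb.subspace_scale)
  qed
  finally show ?thesis .
qed

lemma average_rot_relator: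
  assumes D: "weil_diagram D" and rs: "rot_relation D rs"
  shows "linear_extension average_class (rot_relator D rs) \<in> tilde_relations"
proof -
  have "linear_extension average_class (rot_relator D rs) =
      (\<Sum>r\<leftarrow>rs. average_diagram (D\<lparr>rot := r\<rparr>))"
    by (rule linear_extension_rot_relator[OF D rs, where g = average_diagram]) (rule class_of_diagram)
  also have "\<dots> = (\<Sum>\<pi> | \<pi> permutes {..<length (legs D)}.
      comb_scale (koszul_sign (map snd (legs D)) \<pi> / fact (length (legs D)))
        (rot_relator (D\<lparr>legs := permute_list \<pi> (legs D)\<rparr>) rs))"
    unfolding average_diagram_def rot_relator_def
    by (simp add: sum_list_sum_swap comb_scale_sum_list o_def rot_legs_update)
  also have "\<dots> \<in> tilde_relations"
    using rot_relator_in_relations[OF weil_diagram_permute[OF D] rot_relation_legs(1)[OF rs]]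
    by (intro comb.subspace_sum comb.subspace_scale subspace_relations) simp
  finally show ?thesis .
qed

text \<open>The effect of \<open>iota_leg D k\<close> on \<open>rot\<close>.\<close>

definition iota_rot :: "diagram \<Rightarrow> nat \<Rightarrow> (nat \<Rightarrow> nat) \<Rightarrow> nat \<Rightarrow> nat" where
  "iota_rot D k r =
     (let h = fst (legs D ! k); m = fresh_half_edge D in
      if snd (legs D ! k) = 1 then r
      else r(h := m, m := m + 2, m + 2 := h, m + 1 := m + 1, m + 3 := m + 3))"

lemma iota_leg_rot: "iota_leg (D\<lparr>rot := r\<rparr>) k = (iota_leg D k)\<lparr>rot := iota_rot D k r\<rparr>"
  by (simp add: iota_leg_def iota_rot_def Let_def fresh_half_edge_def)

lemma rot_relation_iota_leg:
  assumes D: "weil_diagram D" and k: "k < length (legs D)" and rs: "rot_relation D rs"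
  shows "rot_relation (iota_leg D k) (map (iota_rot D k) rs)"
proof (cases "snd (legs D ! k) = 1")
  case True
  then show ?thesis
    using rot_relation_legs[OF rot_relation_legs(1)[OF rs]]
    by (simp add: iota_leg_1 iota_rot_def[abs_def] Let_def)
next
  case False
  note DD = weil_diagramD[OF D] and kD = weil_diagram_legD[OF D k]
  have g: "snd (legs D ! k) = 2"
    using False kD(3) by simp
  define h m where h_def: "h = fst (legs D ! k)" and m_def: "m = fresh_half_edge D"
  define E where "E = iota_leg D k"
  note E_eq = E_def[unfolded iota_leg_2[OF g h_def m_def]]
  define u where "u = iota_rot D k"
  have u: "u r = r(h := m, m := m + 2, m + 2 := h, m + 1 := m + 1, m + 3 := m + 3)" for r
    using g by (simp add: u_def iota_rot_def h_def m_def Let_def)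
  note new = fresh_half_edge_notin[OF D m_def]
  have hH: "h \<in> half_edges D" "rot D h = h"
    using kD by (simp_all add: h_def)
  have rotE: "rot E = u (rot D)"
    by (simp add: E_eq u)
  have H: "x \<in> half_edges E" if "x \<in> half_edges D" for x
    using that by (simp add: E_eq)
  have out: "x \<notin> {h, m, m + 1, m + 2, m + 3}" if "x \<in> half_edges D" "rot D x \<noteq> x" for x
    using that hH new by auto
  have r_old: "u r x = r x" if "x \<in> half_edges D" "rot D x \<noteq> x" for r x
    using out[OF that] by (simp add: u)
  have e_old: "edge E x = edge D x" if "x \<in> half_edges D" for x
    using that new by (auto simp: E_eq)
  have upd: "u (r(x := y)) = (u r)(x := y)" if "x \<in> half_edges D" "rot D x \<noteq> x" for r x y
    using out[OF that] by (auto simp: u fun_eq_iff)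
  from rs have "rot_relation E (map u rs)"
  proof (cases rule: rot_relation_cases)
    case (AS v)
    define p q where p_def: "p = rot D v" and q_def: "q = rot D p"
    have p: "p \<in> half_edges D" "rot D p \<noteq> p"
      using AS(1,2) DD(5) rot_inj[OF D] by (auto simp: p_def)
    have q: "q \<in> half_edges D" "rot D q \<noteq> q"
      using p DD(5) rot_inj[OF D] by (auto simp: q_def)
    have "u (reversed_rot (rot D) v) = reversed_rot (rot E) v"
      unfolding reversed_rot_def rotE
      by (simp only: r_old[OF AS(1,2)] r_old[OF p] upd[OF AS(1,2)] upd[OF p] upd[OF q]
          p_def[symmetric] q_def[symmetric])
    then have "map u rs = [rot E, reversed_rot (rot E) v]"
      by (simp add: AS rotE)
    moreover have "rot E v \<noteq> v"
      using AS(2) r_old[OF AS(1,2)] by (simp add: rotE)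
    ultimately show ?thesis
      using H[OF AS(1)] by (intro rot_relationI(1)[of v])
  next
    case (loop l)
    have "rot D l \<noteq> l"
      using loop DD(3) by metis
    then have "edge E l = rot E l"
      using loop r_old e_old by (simp add: rotE)
    moreover have "map u rs = [rot E]"
      by (simp add: loop(3) rotE)
    ultimately show ?thesis
      using H[OF loop(1)] by (intro rot_relationI(2)[of l])
  next
    case (IHX f f' a b c e)
    have f': "f' \<in> half_edges D" and a: "a \<in> half_edges D" and c: "c \<in> half_edges D"
      using IHX(1,2,5,6) DD(2,5) by blast+
    then have b: "b \<in> half_edges D" and e: "e \<in> half_edges D"
      using IHX(3,7) DD(5) by blast+
    have ne: "rot D a \<noteq> a" "rot D b \<noteq> b" "rot D f \<noteq> f" "rot D f' \<noteq> f'" "rot D c \<noteq> c" "rot D e \<noteq> e"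
      using IHX(3-9) by auto
    note U = upd[OF a ne(1)] upd[OF b ne(2)] upd[OF IHX(1) ne(3)] upd[OF f' ne(4)]
      upd[OF c ne(5)] upd[OF e ne(6)]
    have "map u rs = [IHX_rot (rot E) f f' a b c e, IHX_rot (rot E) f f' b c a e,
          IHX_rot (rot E) f f' c a b e]"
      unfolding IHX(10) rotE IHX_rot_def by (simp only: U list.map)
    moreover have "rot E a = b" "rot E b = f" "rot E f = a" "rot E f' = c" "rot E c = e" "rot E e = f'"
      using IHX(3-8) r_old[OF a ne(1)] r_old[OF b ne(2)] r_old[OF IHX(1) ne(3)] r_old[OF f' ne(4)]
        r_old[OF c ne(5)] r_old[OF e ne(6)] by (simp_all add: rotE)
    moreover have "f' = edge E f"
      using e_old[OF IHX(1)] IHX(2) by simp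
    ultimately show ?thesis
      using H[OF IHX(1)] IHX(9) by (intro rot_relationI(3)[of f E f' a b c e])
  qed
  then show ?thesis
    by (simp add: E_def u_def)
qed

lemma iota_rot_relator:
  assumes D: "weil_diagram D" and rs: "rot_relation D rs"
  shows "linear_extension iota_class (rot_relator D rs) \<in> tilde_relations"
proof -
  have 1: "linear_extension iota_class (rot_relator D rs) = (\<Sum>r\<leftarrow>rs. iota_diagram (D\<lparr>rot := r\<rparr>))"
    by (rule linear_extension_rot_relator[OF D rs, where g = iota_diagram]) (rule class_of_diagram)
  show ?thesis
  proof (cases "special D = None")
    case True
    have "(\<Sum>r\<leftarrow>rs. iota_diagram (D\<lparr>rot := r\<rparr>)) =
        (\<Sum>k<length (legs D). comb_scale (prefix_sign D k)
          (rot_relator (iota_leg D k) (map (iota_rot D k) rs)))"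
      using True unfolding iota_diagram_def rot_relator_def
      by (simp add: sum_list_sum_swap comb_scale_sum_list o_def prefix_sign_def iota_leg_rot)
    also have "\<dots> \<in> tilde_relations"
      using rot_relator_in_relations[OF weil_diagram_iota_leg[OF D True] rot_relation_iota_leg[OF D _ rs]]
      by (intro comb.subspace_sum comb.subspace_scale subspace_relations) simp
    finally show ?thesis
      using 1 by simp
  next
    case False
    then have "iota_diagram (D\<lparr>rot := r\<rparr>) = 0" for r
      unfolding iota_diagram_def by (subst if_not_P) simp_all
    then show ?thesis
      using 1 by simp
  qed
qed

lemma operator_respects_tilde_relations:
  assumes "\<And>D rs. weil_diagram D \<Longrightarrow> rot_relation D rs \<Longrightarrow>
      linear_extension gc (rot_relator D rs) \<in> tilde_relations"
    and "v - w \<in> tilde_relations"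
  shows "linear_extension gc v - linear_extension gc w \<in> tilde_relations"
  unfolding linear_extension_diff[symmetric]
  by (rule linear_extension_span[OF _ _ assms(2)[unfolded tilde_relations_def]])
    (use assms(1) in \<open>auto simp: AS_IHX_relators\<close>)

lemma average_Perm_relator:
  assumes D: "weil_diagram D" and k: "Suc k < length (legs D)"
  shows "average_diagram D = comb_scale ((-1) ^ (snd (legs D ! k) * snd (legs D ! Suc k)))
    (average_diagram (D\<lparr>legs := swap_adjacent k (legs D)\<rparr>))"
proof -
  define n where "n = length (legs D)"
  define gs where "gs = map snd (legs D)"
  define t where "t = transpose k (Suc k)"
  define eps :: rat where "eps = (-1) ^ (snd (legs D ! k) * snd (legs D ! Suc k))"
  have t: "t permutes {..<n}"
    unfolding t_def n_def by (rule permutes_swap_id) (use k in auto)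
  have len: "length (swap_adjacent k (legs D)) = n"
    by (simp add: swap_adjacent_def n_def)
  have gs': "map snd (swap_adjacent k (legs D)) = swap_adjacent k gs"
    using k by (simp add: swap_adjacent_def gs_def map_update)
  have perm: "permute_list (t \<circ> \<pi>) (swap_adjacent k (legs D)) = permute_list \<pi> (legs D)"
    if "\<pi> permutes {..<n}" for \<pi>
  proof -
    have "permute_list (t \<circ> \<pi>) (swap_adjacent k (legs D)) =
        permute_list \<pi> (permute_list t (permute_list t (legs D)))"
      using that k by (simp add: swap_adjacent_conv_permute_list t_def[symmetric] permute_list_compose n_def)
    also have "permute_list t (permute_list t (legs D)) = permute_list (t \<circ> t) (legs D)"
      using t by (simp add: permute_list_compose n_def)
    also have "t \<circ> t = id"
      by (simp add: t_def)
    finally show ?thesis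
      by (simp only: permute_list_id)
  qed
  have sign: "eps * koszul_sign (swap_adjacent k gs) (t \<circ> \<pi>) = koszul_sign gs \<pi>"
    if "\<pi> permutes {..<n}" for \<pi>
    using koszul_sign_step[of k gs \<pi>] that k by (simp add: gs_def n_def t_def eps_def)
  have "comb_scale eps (average_diagram (D\<lparr>legs := swap_adjacent k (legs D)\<rparr>)) =
      (\<Sum>\<pi> | \<pi> permutes {..<n}. comb_scale (eps * (koszul_sign (swap_adjacent k gs) \<pi> / fact n))
          (diagram_vec (D\<lparr>legs := permute_list \<pi> (swap_adjacent k (legs D))\<rparr>)))"
    by (simp add: average_diagram_def len gs' comb.scale_sum_right)
  also have "\<dots> = (\<Sum>\<pi> | \<pi> permutes {..<n}.
      comb_scale (eps * (koszul_sign (swap_adjacent k gs) (t \<circ> \<pi>) / fact n))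
          (diagram_vec (D\<lparr>legs := permute_list (t \<circ> \<pi>) (swap_adjacent k (legs D))\<rparr>)))"
    by (rule setum_permutations_compose_left[OF t])
  also have "\<dots> = average_diagram D"
    unfolding average_diagram_def n_def[symmetric] gs_def[symmetric]
    by (intro sum.cong refl) (simp add: perm sign[symmetric])
  finally show ?thesis
    by (simp add: eps_def)
qed

lemma weil_diagram_swap_adjacent:
  assumes "weil_diagram D" "Suc k < length (legs D)"
  shows "weil_diagram (D\<lparr>legs := swap_adjacent k (legs D)\<rparr>)"
  unfolding swap_adjacent_conv_permute_list[OF assms(2)]
  by (rule weil_diagram_permute[OF assms(1)]) (use assms(2) in \<open>auto intro: permutes_swap_id\<close>)

lemma average_respects_relations:
  assumes "v - w \<in> weil_relations"
  shows "linear_extension average_class v - linear_extension average_class w \<in> tilde_relations"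
  unfolding linear_extension_diff[symmetric]
proof (rule linear_extension_span[OF _ _ assms[unfolded weil_relations_def]])
  fix x
  assume "x \<in> AS_relators \<union> IHX_relators \<union> Perm_relators"
  then consider "x \<in> AS_relators \<union> IHX_relators" | "x \<in> Perm_relators"
    by blast
  then show "linear_extension average_class x \<in> tilde_relations"
  proof cases
    case 1
    then show ?thesis
      using average_rot_relator by (auto simp: AS_IHX_relators)
  next
    case 2
    then obtain D k where D: "weil_diagram D" "Suc k < length (legs D)"
      and x: "x = diagram_vec D - comb_scale ((-1) ^ (snd (legs D ! k) * snd (legs D ! Suc k)))
        (diagram_vec (D\<lparr>legs := swap_adjacent k (legs D)\<rparr>))"
      unfolding Perm_relators_def by blast
    have "linear_extension average_class x = 0"
      unfolding x linear_extension_diff linear_extension_scale linear_extension_vec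
        class_of_diagram(3)[OF D(1)] class_of_diagram(3)[OF weil_diagram_swap_adjacent[OF D]]
      using average_Perm_relator[OF D] by simp
    then show ?thesis
      by simp
  qed
qed simp

section \<open>The operators on the quotient spaces\<close>

text \<open>
  \<open>tilde_d\<close> is \<open>d\<close> on diagrams without and \<open>d\<^sub>\<iota>\<close> on diagrams with a special vertex. In the same way
  \<open>tau\<close> and \<open>chi\<close> are defined on both kinds of diagrams at once.
\<close>

lift_definition tilde_d :: "weil_tilde \<Rightarrow> weil_tilde" is "linear_extension differential_class"
  by (rule operator_respects_tilde_relations[OF differential_rot_relator])

lift_definition tilde_iota :: "weil_tilde \<Rightarrow> weil_tilde" is "linear_extension iota_class"
  by (rule operator_respects_tilde_relations[OF iota_rot_relator])

lift_definition tau :: "weil_tilde \<Rightarrow> weil" is "\<lambda>v. v"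
  unfolding tilde_relations_def weil_relations_def
  using comb.span_mono[of "AS_relators \<union> IHX_relators"] by blast

lift_definition chi :: "weil \<Rightarrow> weil_tilde" is "linear_extension average_class"
  by (rule average_respects_relations)

end

theory Submission
  imports Defs "HOL-Library.Multiset" "HOL-Combinatorics.Multiset_Permutations"
begin

text \<open>
  Let $\alpha$ and $F = d\alpha$ stand for legs of grade 1 and 2, and let the words in them be
  multiplied by concatenation. The substitution $\alpha \mapsto (1-t)\,\alpha\otimes 1 + t\,1\otimes\alpha$,
  $F \mapsto (1-t)\,F\otimes 1 + t\,1\otimes F + dt\,(1\otimes\alpha - \alpha\otimes 1)$ is compatible with $d$
  and $\iota$. It joins $x \mapsto x\otimes 1$ to $x \mapsto 1\otimes x$, and symmetrizing the right
  factor and concatenating turns these two into the identity and $\chi\circ\tau$. Integrating over $t$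
  gives the homotopy, up to sign: make one leg of grade 2 a leg of grade 1, distribute the legs over the
  two factors with weight $\int_0^1 (1-t)^a t^b\,dt = a!\,b!/(a+b+1)!$, where $a$ and $b$ count the other
  legs in each factor, and symmetrize the right factor. A removed leg contributes to
  both factors, and $(1-t) + t = 1$ becomes the identity $\mu(a+1,b) + \mu(a,b+1) = \mu(a,b)$ of the weights.
\<close>

text \<open>Peeling off the first leg multiplies the integrand by 1-t or t, which shifts the weight
  to \<mu>(a+1,b) or \<mu>(a,b+1). So the inductions on words cannot fix the weights: they run over
  all weights satisfying that identity, a class closed under both shifts, and the beta integrals
  enter only where the derivative of (1-t)^a t^b is integrated. The term in dt is used with the
  opposite sign, because the identity map is the value at t = 0 and the required difference is the
  value at t = 0 minus that at t = 1. Everything is exact on words: AS and IHX concern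
  \<open>rot\<close>, which the homotopy leaves alone, and Perm enters only through \<tau>. The
  obstacle is \<iota>: it alters the underlying diagram, and it removes legs although symmetrization
  is normalized by the length of the word.\<close>

type_synonym leg = "nat \<times> nat"

abbreviation word_grade :: "leg list \<Rightarrow> nat" where
  "word_grade ws \<equiv> sum_list (map snd ws)"

section \<open>Signs and transposed operators\<close>

definition signed :: "nat \<Rightarrow> diagram_comb \<Rightarrow> diagram_comb" where
  "signed n = comb_scale ((-1) ^ n)"

lemma signed_if: "signed n v = (if even n then v else - v)"
  by (simp add: signed_def)

lemma signed_simps [simp]:
  "signed 0 v = v" "signed n 0 = 0" "signed m (signed n v) = signed (m + n) v"
  by (auto simp: signed_if)

lemma signed_linear:
  "signed n (v + w) = signed n v + signed n w" "signed n (v - w) = signed n v - signed n w"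
  "signed n (comb_scale c v) = comb_scale c (signed n v)"
  by (simp_all add: signed_if)

lemma signed_cong: "even m = even n \<Longrightarrow> signed m v = signed n v"
  by (simp add: signed_if)

text \<open>
  An operator from a free vector space on words (or pairs of words) is represented by its transpose \<open>T\<close>:
  \<open>T e\<close> is the value at the image of a fixed word of the linear extension of \<open>e\<close>. So in
  a composite the operator that acts first is written outermost.
\<close>

definition combination :: "'b set \<Rightarrow> (('b \<Rightarrow> diagram_comb) \<Rightarrow> diagram_comb) \<Rightarrow> bool" where
  "combination P T \<longleftrightarrow>
     (\<exists>ts. snd ` set ts \<subseteq> P \<and> (\<forall>e. T e = (\<Sum>t\<leftarrow>ts. comb_scale (fst t) (e (snd t)))))"

lemma combination_eval: "p \<in> P \<Longrightarrow> combination P (\<lambda>e. e p)"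
  unfolding combination_def by (rule exI[of _ "[(1, p)]"]) simp

lemma combination_zero: "combination P (\<lambda>e. 0)"
  unfolding combination_def by (rule exI[of _ "[]"]) simp

lemma combination_add:
  assumes "combination P T" "combination P U"
  shows "combination P (\<lambda>e. T e + U e)"
proof -
  obtain ts us where "snd ` set ts \<subseteq> P" "\<forall>e. T e = (\<Sum>t\<leftarrow>ts. comb_scale (fst t) (e (snd t)))"
    "snd ` set us \<subseteq> P" "\<forall>e. U e = (\<Sum>t\<leftarrow>us. comb_scale (fst t) (e (snd t)))"
    using assms unfolding combination_def by blast
  then show ?thesis
    unfolding combination_def by (intro exI[of _ "ts @ us"]) auto
qed

lemma combination_scale:
  assumes "combination P T"
  shows "combination P (\<lambda>e. comb_scale c (T e))"
proof -
  obtain ts where "snd ` set ts \<subseteq> P" "\<forall>e. T e = (\<Sum>t\<leftarrow>ts. comb_scale (fst t) (e (snd t)))"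
    using assms unfolding combination_def by blast
  then show ?thesis
    unfolding combination_def
    by (intro exI[of _ "map (map_prod ((*) c) id) ts"])
      (auto simp: comb_scale_sum_list o_def)
qed

lemma combination_signed: "combination P T \<Longrightarrow> combination P (\<lambda>e. signed n (T e))"
  unfolding signed_def by (rule combination_scale)

lemma combination_diff:
  assumes "combination P T" "combination P U"
  shows "combination P (\<lambda>e. T e - U e)"
  using combination_add[OF assms(1) combination_signed[OF assms(2), of 1]] by (simp add: signed_if)

lemma combination_bind:
  assumes "combination P T" "\<And>p. p \<in> P \<Longrightarrow> combination Q (U p)"
  shows "combination Q (\<lambda>e. T (\<lambda>p. U p e))"
proof -
  obtain ts where ts: "snd ` set ts \<subseteq> P" "\<And>e. T e = (\<Sum>t\<leftarrow>ts. comb_scale (fst t) (e (snd t)))"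
    using assms(1) unfolding combination_def by blast
  have "combination Q (\<lambda>e. \<Sum>t\<leftarrow>ts. comb_scale (fst t) (U (snd t) e))"
    using ts(1)
    by (induction ts) (auto intro!: combination_zero combination_add combination_scale assms(2))
  then show ?thesis
    by (simp add: ts(2))
qed

lemma combination_linear:
  assumes "combination P T"
  shows "T (\<lambda>p. e p + e' p) = T e + T e'"
    and "T (\<lambda>p. e p - e' p) = T e - T e'"
    and "T (\<lambda>p. comb_scale c (e p)) = comb_scale c (T e)"
    and "T (\<lambda>p. signed n (e p)) = signed n (T e)"
    and "T (\<lambda>p. 0) = 0"
proof -
  obtain ts where ts: "\<And>e. T e = (\<Sum>t\<leftarrow>ts. comb_scale (fst t) (e (snd t)))"
    using assms unfolding combination_def by blast
  show "T (\<lambda>p. e p + e' p) = T e + T e'"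
    unfolding ts by (simp add: comb.scale_right_distrib sum_list_addf)
  show "T (\<lambda>p. e p - e' p) = T e - T e'"
    unfolding ts by (simp add: comb.scale_right_diff_distrib sum_list_subtractf)
  show scale: "T (\<lambda>p. comb_scale c (e p)) = comb_scale c (T e)" for c
    unfolding ts by (simp add: comb_scale_sum_list o_def mult.commute)
  show "T (\<lambda>p. signed n (e p)) = signed n (T e)"
    unfolding signed_def by (rule scale)
  show "T (\<lambda>p. 0) = 0"
    using scale[of 0] by simp
qed

lemma combination_closed:
  assumes "combination P T" "comb.subspace S" "\<And>p. p \<in> P \<Longrightarrow> e p \<in> S"
  shows "T e \<in> S"
proof -
  obtain ts where ts: "snd ` set ts \<subseteq> P" "\<And>e. T e = (\<Sum>t\<leftarrow>ts. comb_scale (fst t) (e (snd t)))"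
    using assms(1) unfolding combination_def by blast
  show ?thesis
    unfolding ts(2) using ts(1)
    by (induction ts)
      (auto intro!: comb.subspace_0 comb.subspace_add comb.subspace_scale assms)
qed

text \<open>This is the use of \<open>P\<close>: it confines the arguments to words with known
  letters, so that identities valid only for leg lists of genuine diagrams can be applied under
  \<open>T\<close>.\<close>

lemma combination_cong:
  assumes "combination P T" "\<And>p. p \<in> P \<Longrightarrow> e p = e' p"
  shows "T e = T e'"
proof -
  obtain ts where ts: "snd ` set ts \<subseteq> P" "\<And>e. T e = (\<Sum>t\<leftarrow>ts. comb_scale (fst t) (e (snd t)))"
    using assms(1) unfolding combination_def by blast
  then show ?thesis
    unfolding ts(2) using assms(2) by (intro arg_cong[of _ _ sum_list] map_cong) auto
qed

lemma combination_exchange: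
  assumes "combination P T" "combination Q U"
  shows "T (\<lambda>p. U (\<lambda>q. E p q)) = U (\<lambda>q. T (\<lambda>p. E p q))"
proof -
  obtain ts where ts: "\<And>e. T e = (\<Sum>t\<leftarrow>ts. comb_scale (fst t) (e (snd t)))"
    using assms(1) unfolding combination_def by blast
  have "(\<Sum>t\<leftarrow>ts. comb_scale (fst t) (U (E (snd t)))) =
      U (\<lambda>q. \<Sum>t\<leftarrow>ts. comb_scale (fst t) (E (snd t) q))" for ts :: "(rat \<times> 'a) list"
    by (induction ts) (simp_all add: combination_linear[OF assms(2)])
  then show ?thesis
    by (simp add: ts)
qed

lemma combination_linear_extension:
  assumes "combination P T"
  shows "linear_extension g (T e) = T (\<lambda>p. linear_extension g (e p))"
proof -
  obtain ts where ts: "\<And>e. T e = (\<Sum>t\<leftarrow>ts. comb_scale (fst t) (e (snd t)))"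
    using assms unfolding combination_def by blast
  show ?thesis
    unfolding ts by (simp add: linear_extension_sum_list linear_extension_scale o_def)
qed

lemmas combination_intros = combination_zero combination_add combination_diff combination_signed
  combination_scale

section \<open>Operators on words of legs\<close>

text \<open>
  The rule \<open>r\<close> replaces a leg by a word in place, or by zero if it is \<open>None\<close>. The functional \<open>E\<close> also
  receives the replaced leg, because \<open>\<iota>\<close> changes the underlying diagram according to it.
\<close>

fun leg_op :: "(leg \<Rightarrow> leg list option) \<Rightarrow> (leg \<Rightarrow> leg list \<Rightarrow> diagram_comb) \<Rightarrow> leg list \<Rightarrow> diagram_comb"
  where
  "leg_op r E [] = 0"
| "leg_op r E (x # xs) = (case r x of None \<Rightarrow> 0 | Some w \<Rightarrow> E x (w @ xs)) +
     signed (snd x) (leg_op r (\<lambda>z ys. E z (x # ys)) xs)"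

text \<open>Only parity matters for signs, so one notion covers the rule of degree +1 for
  \<open>d\<close> and that of degree -1 for \<iota>.\<close>

definition odd_rule :: "(leg \<Rightarrow> leg list option) \<Rightarrow> bool" where
  "odd_rule r \<longleftrightarrow> (\<forall>x w. r x = Some w \<longrightarrow> odd (snd x + word_grade w) \<and> length w \<le> 1)"

lemma odd_ruleD:
  assumes "odd_rule r" "r x = Some w"
  shows "odd (snd x + word_grade w)" "length w \<le> 1"
  using assms unfolding odd_rule_def by blast+

lemma odd_ruleE:
  assumes "odd_rule r"
  obtains "r x = None" | "r x = Some []" "odd (snd x)" | y where "r x = Some [y]" "odd (snd x + snd y)"
proof (cases "r x")
  case (Some w)
  with assms have "odd (snd x + word_grade w)" "length w \<le> 1"
    unfolding odd_rule_def by blast+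
  with Some that(2,3) show ?thesis
    by (cases w) auto
qed (use that in auto)

lemma combination_leg_op: "combination UNIV (\<lambda>F. leg_op r (\<lambda>z ys. F (z, ys)) xs)"
proof (induction xs)
  case (Cons x xs)
  have 1: "combination UNIV (\<lambda>F. leg_op r (\<lambda>z ys. F (z, x # ys)) xs)"
    using combination_bind[OF Cons, of UNIV "\<lambda>(z, ys) F. F (z, x # ys)"]
    by (simp add: combination_eval split_def)
  show ?case
    by (cases "r x") (auto intro!: combination_intros combination_eval 1)
qed (simp add: combination_zero)

lemma leg_op_linear:
  "leg_op r (\<lambda>z ys. E z ys + E' z ys) xs = leg_op r E xs + leg_op r E' xs"
  "leg_op r (\<lambda>z ys. E z ys - E' z ys) xs = leg_op r E xs - leg_op r E' xs"
  "leg_op r (\<lambda>z ys. comb_scale c (E z ys)) xs = comb_scale c (leg_op r E xs)"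
  "leg_op r (\<lambda>z ys. signed n (E z ys)) xs = signed n (leg_op r E xs)"
  "leg_op r (\<lambda>z ys. 0) xs = 0"
  using combination_linear(1,2)[OF combination_leg_op[of r xs], of "case_prod E" "case_prod E'"]
    combination_linear(3)[OF combination_leg_op[of r xs], of c "case_prod E"]
    combination_linear(4)[OF combination_leg_op[of r xs], of n "case_prod E"]
    combination_linear(5)[OF combination_leg_op[of r xs]]
  by (simp_all add: split_def)

text \<open>The graded Leibniz rule: an odd operator that reaches \<open>ys\<close> has passed all
  of \<open>xs\<close>.\<close>

lemma leg_op_append:
  "leg_op r E (xs @ ys) = leg_op r (\<lambda>z xs'. E z (xs' @ ys)) xs +
    signed (word_grade xs) (leg_op r (\<lambda>z ys'. E z (xs @ ys')) ys)"
  by (induction xs arbitrary: E) (auto simp: signed_linear ac_simps split: option.splits)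

lemma leg_op_conv_sum:
  "leg_op r E xs = (\<Sum>k<length xs. signed (word_grade (take k xs))
     (case r (xs ! k) of None \<Rightarrow> 0 | Some w \<Rightarrow> E (xs ! k) (take k xs @ w @ drop (Suc k) xs)))"
proof (induction xs arbitrary: E)
  case (Cons x xs)
  have "signed n (sum f A) = (\<Sum>a\<in>A. signed n (f a))" for n and f :: "nat \<Rightarrow> diagram_comb" and A
    by (simp add: signed_def comb.scale_sum_right)
  then show ?case
    by (simp add: Cons sum.lessThan_Suc_shift del: sum.lessThan_Suc cong: option.case_cong)
qed simp

text \<open>All words produced from \<open>xs\<close> have grade of parity opposite to that of
  \<open>xs\<close>, so a sign depending on the grade of the result is constant.\<close>

lemma leg_op_signed:
  assumes "odd_rule r"
  shows "leg_op r (\<lambda>z ys. signed (k * word_grade ys) (E z ys)) xs =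
    signed (k * Suc (word_grade xs)) (leg_op r E xs)"
proof (induction xs arbitrary: E)
  case (Cons x xs)
  have "leg_op r (\<lambda>z ys. signed (k * word_grade (x # ys)) (E z (x # ys))) xs =
      signed (k * Suc (word_grade (x # xs))) (leg_op r (\<lambda>z ys. E z (x # ys)) xs)"
    using Cons[of "\<lambda>z ys. signed (k * snd x) (E z (x # ys))"]
    by (simp add: leg_op_linear distrib_left ac_simps)
  moreover have "signed (k * word_grade (w @ xs)) v = signed (k * Suc (word_grade (x # xs))) v"
    if "r x = Some w" for w v
    using odd_ruleD(1)[OF assms that] by (intro signed_cong) auto
  ultimately show ?case
    by (auto simp: signed_linear ac_simps split: option.splits)
qed simp

subsection \<open>Unshuffles\<close>

text \<open>The coproduct of the signed shuffle product, with weights depending on the lengths of both factors.\<close>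

fun unshuffle ::
    "(nat \<Rightarrow> nat \<Rightarrow> rat) \<Rightarrow> (leg list \<Rightarrow> leg list \<Rightarrow> diagram_comb) \<Rightarrow> leg list \<Rightarrow> diagram_comb" where
  "unshuffle \<mu> G [] = comb_scale (\<mu> 0 0) (G [] [])"
| "unshuffle \<mu> G (x # xs) =
     unshuffle (\<lambda>a b. \<mu> (Suc a) b) (\<lambda>A B. G (x # A) B) xs +
     unshuffle (\<lambda>a b. \<mu> a (Suc b)) (\<lambda>A B. signed (snd x * word_grade A) (G A (x # B))) xs"

text \<open>The harmonic functions on the Pascal graph; integrals of (1-t)^a t^b against any measure
  on [0,1] are examples.\<close>

definition harmonic :: "(nat \<Rightarrow> nat \<Rightarrow> rat) \<Rightarrow> bool" where
  "harmonic \<mu> \<longleftrightarrow> (\<forall>a b. \<mu> (Suc a) b + \<mu> a (Suc b) = \<mu> a b)"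

lemma harmonic_shift:
  assumes "harmonic \<mu>"
  shows "harmonic (\<lambda>a b. \<mu> (Suc a) b)" "harmonic (\<lambda>a b. \<mu> a (Suc b))"
  using assms by (auto simp: harmonic_def)

lemma combination_unshuffle:
  "combination {(A, B). mset A + mset B = mset xs} (\<lambda>F. unshuffle \<mu> (\<lambda>A B. F (A, B)) xs)"
proof (induction xs arbitrary: \<mu>)
  case Nil
  show ?case
    by (auto intro!: combination_intros combination_eval)
next
  case (Cons x xs)
  let ?P = "{(A, B). mset A + mset B = mset (x # xs)}"
  have "combination ?P (\<lambda>F. unshuffle \<mu> (\<lambda>A B. F (x # A, B)) xs)" for \<mu>
    by (rule combination_bind[OF Cons, of ?P "\<lambda>(A, B) F. F (x # A, B)" \<mu>, unfolded split_conv])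
      (auto intro!: combination_eval)
  moreover have "combination ?P (\<lambda>F. unshuffle \<mu> (\<lambda>A B. signed (snd x * word_grade A) (F (A, x # B))) xs)" for \<mu>
    by (rule combination_bind[OF Cons, of ?P
          "\<lambda>(A, B) F. signed (snd x * word_grade A) (F (A, x # B))" \<mu>, unfolded split_conv])
      (auto intro!: combination_eval combination_intros)
  ultimately show ?case
    by (auto intro!: combination_intros)
qed

lemma unshuffle_linear:
  "unshuffle \<mu> (\<lambda>A B. G A B + G' A B) xs = unshuffle \<mu> G xs + unshuffle \<mu> G' xs"
  "unshuffle \<mu> (\<lambda>A B. G A B - G' A B) xs = unshuffle \<mu> G xs - unshuffle \<mu> G' xs"
  "unshuffle \<mu> (\<lambda>A B. signed n (G A B)) xs = signed n (unshuffle \<mu> G xs)"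
  "unshuffle \<mu> (\<lambda>A B. 0) xs = 0"
  using combination_linear(1,2)[OF combination_unshuffle[of xs \<mu>], of "case_prod G" "case_prod G'"]
    combination_linear(4)[OF combination_unshuffle[of xs \<mu>], of n "case_prod G"]
    combination_linear(5)[OF combination_unshuffle[of xs \<mu>]]
  by (simp_all add: split_def)

lemma unshuffle_weight:
  "unshuffle (\<lambda>a b. \<mu> a b + \<nu> a b) G xs = unshuffle \<mu> G xs + unshuffle \<nu> G xs"
  "unshuffle (\<lambda>a b. \<mu> a b - \<nu> a b) G xs = unshuffle \<mu> G xs - unshuffle \<nu> G xs"
  "unshuffle (\<lambda>a b. 0) G xs = 0"
  by (induction xs arbitrary: \<mu> \<nu> G)
    (simp_all add: comb.scale_left_distrib comb.scale_left_diff_distrib)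

lemma unshuffle_harmonic:
  assumes "harmonic \<mu>"
  shows "unshuffle \<mu> G xs =
    unshuffle (\<lambda>a b. \<mu> (Suc a) b) G xs + unshuffle (\<lambda>a b. \<mu> a (Suc b)) G xs"
  using assms by (simp add: unshuffle_weight(1)[symmetric] harmonic_def)

text \<open>The odd derivation r \<otimes> 1 + 1 \<otimes> r, with the Koszul sign for carrying r
  past the left factor.\<close>

definition leg_op_pair where
  "leg_op_pair r G A B = leg_op r (\<lambda>z A'. G z A' B) A +
     signed (word_grade A) (leg_op r (\<lambda>z B'. G z A B') B)"

lemma leg_op_pair_left:
  "leg_op_pair r G (x # A) = (\<lambda>B.
    (case r x of None \<Rightarrow> 0 | Some w \<Rightarrow> G x (w @ A) B) +
    signed (snd x) (leg_op_pair r (\<lambda>z A B. G z (x # A) B) A B))"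
  by (rule ext) (simp add: leg_op_pair_def signed_linear ac_simps)

text \<open>If r acts on \<open>x\<close>, the replacement has the opposite parity, whence
  \<open>Suc (snd x)\<close>. If r acts on \<open>A\<close>, the grade of \<open>A\<close> changes
  parity, which \<open>leg_op_signed\<close> absorbs into \<open>signed (snd x)\<close>.\<close>

lemma leg_op_pair_right:
  assumes "odd_rule r"
  shows "signed (snd x * word_grade A) (leg_op_pair r G A (x # B)) =
    (case r x of None \<Rightarrow> 0 | Some w \<Rightarrow> signed (Suc (snd x) * word_grade A) (G x A (w @ B))) +
    signed (snd x) (leg_op_pair r (\<lambda>z A B. signed (snd x * word_grade A) (G z A (x # B))) A B)"
  unfolding leg_op_pair_def leg_op_signed[OF assms] 
  by (simp add: signed_linear leg_op_linear ac_simps split: option.splits) (simp add: signed_if)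

text \<open>The coproduct intertwines r with the derivation that r induces on pairs of words. Only
  the removal of a leg interferes with the weights.\<close>

lemma leg_op_unshuffle:
  assumes "odd_rule r" "harmonic \<mu>"
  shows "leg_op r (\<lambda>z ys. unshuffle \<mu> (G z) ys) xs = unshuffle \<mu> (leg_op_pair r G) xs"
  using assms(2)
proof (induction xs arbitrary: \<mu> G)
  case Nil
  then show ?case
    by (simp add: leg_op_pair_def)
next
  case (Cons x xs)
  have 1: "(case r x of None \<Rightarrow> 0 | Some w \<Rightarrow> unshuffle \<mu> (G x) (w @ xs)) =
    unshuffle (\<lambda>a b. \<mu> (Suc a) b) (\<lambda>A B. case r x of None \<Rightarrow> 0 | Some w \<Rightarrow> G x (w @ A) B) xs +
    unshuffle (\<lambda>a b. \<mu> a (Suc b)) (\<lambda>A B. case r x of None \<Rightarrow> 0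
      | Some w \<Rightarrow> signed (Suc (snd x) * word_grade A) (G x A (w @ B))) xs"
    using odd_ruleE[OF assms(1), of x]
  proof cases
    case 1
    then show ?thesis by (simp add: unshuffle_linear)
  next
    \<comment> \<open>A removed leg has odd grade, so no sign arises, and the harmonic identity
      shares the weight between its two possible factors.\<close>
    case 2
    then have "signed (Suc (snd x) * word_grade A) v = v" for A v
      by (simp add: signed_if)
    with 2 show ?thesis
      by (simp add: unshuffle_harmonic[OF Cons.prems, of "G x"] del: mult_Suc)
  next
    case (3 y)
    then have "signed (Suc (snd x) * word_grade A) v = signed (snd y * word_grade A) v" for A v
      by (intro signed_cong) auto
    with 3 show ?thesis
      by (simp del: mult_Suc)
  qed
  show ?case
    by (simp add: 1 Cons.IH[OF harmonic_shift(1)[OF Cons.prems]] Cons.IH[OF harmonic_shift(2)[OF Cons.prems]]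
        leg_op_pair_left leg_op_pair_right[OF assms(1)] unshuffle_linear leg_op_linear signed_linear
        ac_simps del: mult_Suc)
qed

section \<open>Unshuffles that lower one leg\<close>

abbreviation lower :: "leg \<Rightarrow> leg" where
  "lower x \<equiv> (fst x, 1)"

text \<open>The integrated term in dt with reversed sign. Lowering is odd, hence
  \<open>signed (snd x)\<close> for passing \<open>x\<close>; the sign \<open>word_grade A\<close>
  carries the new leg of grade 1 past \<open>A\<close>. The lowered leg does not shift the
  weight.\<close>

fun unshuffle_lower ::
    "(nat \<Rightarrow> nat \<Rightarrow> rat) \<Rightarrow> (leg list \<Rightarrow> leg list \<Rightarrow> diagram_comb) \<Rightarrow> leg list \<Rightarrow> diagram_comb" where
  "unshuffle_lower \<mu> G [] = 0"
| "unshuffle_lower \<mu> G (x # xs) =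
     (if snd x = 2
      then unshuffle \<mu> (\<lambda>A B. G (lower x # A) B - signed (word_grade A) (G A (lower x # B))) xs
      else 0) +
     signed (snd x)
       (unshuffle_lower (\<lambda>a b. \<mu> (Suc a) b) (\<lambda>A B. G (x # A) B) xs +
        unshuffle_lower (\<lambda>a b. \<mu> a (Suc b)) (\<lambda>A B. signed (snd x * word_grade A) (G A (x # B))) xs)"

text \<open>The multiset equation says that one leg \<open>x\<close> has become
  \<open>lower x\<close>; inserting on both sides avoids subtraction of multisets.\<close>

lemma combination_unshuffle_lower:
  "combination {(A, B). \<exists>x\<in>#mset xs. snd x = 2 \<and>
      add_mset x (mset A + mset B) = add_mset (lower x) (mset xs)}
    (\<lambda>F. unshuffle_lower \<mu> (\<lambda>A B. F (A, B)) xs)"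
proof (induction xs arbitrary: \<mu>)
  case Nil
  show ?case
    by (auto intro!: combination_intros)
next
  case (Cons x xs)
  let ?P = "{(A, B). \<exists>y\<in>#mset (x # xs). snd y = 2 \<and>
      add_mset y (mset A + mset B) = add_mset (lower y) (mset (x # xs))}"
  have "combination ?P (\<lambda>F. unshuffle_lower \<mu> (\<lambda>A B. F (x # A, B)) xs)" for \<mu>
    by (rule combination_bind[OF Cons, of ?P "\<lambda>(A, B) F. F (x # A, B)" \<mu>, unfolded split_conv])
      (auto intro!: combination_eval simp: add_mset_commute)
  moreover have "combination ?P (\<lambda>F. unshuffle_lower \<mu> (\<lambda>A B. signed (snd x * word_grade A) (F (A, x # B))) xs)" for \<mu>
    by (rule combination_bind[OF Cons, of ?P
          "\<lambda>(A, B) F. signed (snd x * word_grade A) (F (A, x # B))" \<mu>, unfolded split_conv])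
      (auto intro!: combination_eval combination_intros simp: add_mset_commute)
  moreover have "combination ?P (\<lambda>F. if snd x = 2 then
      unshuffle \<mu> (\<lambda>A B. F (lower x # A, B) - signed (word_grade A) (F (A, lower x # B))) xs else 0)"
    for \<mu>
  proof (cases "snd x = 2")
    case True
    show ?thesis
      unfolding if_P[OF True]
      by (rule combination_bind[OF combination_unshuffle, of xs ?P
            "\<lambda>(A, B) F. F (lower x # A, B) - signed (word_grade A) (F (A, lower x # B))" \<mu>, unfolded split_conv])
        (use True in \<open>auto intro!: combination_eval combination_intros simp: add_mset_commute\<close>)
  next
    case False
    show ?thesis
      unfolding if_not_P[OF False] by (rule combination_zero)
  qed
  ultimately show ?case
    unfolding unshuffle_lower.simps by (intro combination_add combination_signed)
qed

lemma unshuffle_lower_linear: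
  "unshuffle_lower \<mu> (\<lambda>A B. G A B + G' A B) xs = unshuffle_lower \<mu> G xs + unshuffle_lower \<mu> G' xs"
  "unshuffle_lower \<mu> (\<lambda>A B. signed n (G A B)) xs = signed n (unshuffle_lower \<mu> G xs)"
  "unshuffle_lower \<mu> (\<lambda>A B. 0) xs = 0"
  using combination_linear(1)[OF combination_unshuffle_lower[of xs \<mu>], of "case_prod G" "case_prod G'"]
    combination_linear(4)[OF combination_unshuffle_lower[of xs \<mu>], of n "case_prod G"]
    combination_linear(5)[OF combination_unshuffle_lower[of xs \<mu>]]
  by (simp_all add: split_def)

lemma unshuffle_lower_weight:
  "unshuffle_lower (\<lambda>a b. \<mu> a b + \<nu> a b) G xs = unshuffle_lower \<mu> G xs + unshuffle_lower \<nu> G xs"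
  by (induction xs arbitrary: \<mu> \<nu> G) (simp_all add: unshuffle_weight signed_linear)

lemma unshuffle_lower_harmonic:
  assumes "harmonic \<mu>"
  shows "unshuffle_lower \<mu> G xs =
    unshuffle_lower (\<lambda>a b. \<mu> (Suc a) b) G xs + unshuffle_lower (\<lambda>a b. \<mu> a (Suc b)) G xs"
  using assms by (simp add: unshuffle_lower_weight[symmetric] harmonic_def)

text \<open>
  The effect on a single leg of the anticommutator of \<open>r\<close> with the substitution of \<open>lower x\<close> for \<open>x\<close>: the
  leg seen by \<open>r\<close>, and the resulting word.
\<close>

definition anticommutator :: "(leg \<Rightarrow> leg list option) \<Rightarrow> leg \<Rightarrow> (leg \<times> leg list) option" where
  "anticommutator r x =
     (if snd x = 2 then map_option (Pair (lower x)) (r (lower x))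
      else case r x of Some [y] \<Rightarrow> if snd y = 2 then Some (x, [lower y]) else None | _ \<Rightarrow> None)"

text \<open>The marked leg does not count in the weights. Unlike lowering, the operation is even, so
  passing \<open>x\<close> costs no sign beyond that of the unshuffle.\<close>

fun unshuffle_mark :: "(leg \<Rightarrow> (leg \<times> leg list) option) \<Rightarrow> (nat \<Rightarrow> nat \<Rightarrow> rat) \<Rightarrow>
    (leg \<Rightarrow> leg list \<Rightarrow> leg list \<Rightarrow> diagram_comb) \<Rightarrow> leg list \<Rightarrow> diagram_comb" where
  "unshuffle_mark c \<mu> G [] = 0"
| "unshuffle_mark c \<mu> G (x # xs) =
     (case c x of None \<Rightarrow> 0 | Some (z, u) \<Rightarrow>
        unshuffle \<mu> (\<lambda>A B. G z (u @ A) B - signed (snd x * word_grade A) (G z A (u @ B))) xs) +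
     unshuffle_mark c (\<lambda>a b. \<mu> (Suc a) b) (\<lambda>z A B. G z (x # A) B) xs +
     unshuffle_mark c (\<lambda>a b. \<mu> a (Suc b)) (\<lambda>z A B. signed (snd x * word_grade A) (G z A (x # B))) xs"

text \<open>Both operations are odd, so the two orders cancel when they act on different legs; this
  needs r to commute with the unshuffle, hence harmonicity. What remains acts twice on one
  leg.\<close>

lemma leg_op_unshuffle_lower:
  assumes r: "odd_rule r" and "harmonic \<mu>"
  shows "leg_op r (\<lambda>z ys. unshuffle_lower \<mu> (G z) ys) xs + unshuffle_lower \<mu> (leg_op_pair r G) xs =
    unshuffle_mark (anticommutator r) \<mu> G xs"
  using assms(2)
proof (induction xs arbitrary: \<mu> G)
  case Nil
  then show ?case
    by simp
next
  case (Cons x xs)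
  note h = harmonic_shift[OF Cons.prems]
  define M where "M = (\<lambda>\<alpha> z A B. G z (\<alpha> # A) B - signed (word_grade A) (G z A (\<alpha> # B)))"
  \<comment> \<open>r acts on the head \<open>x\<close>. Lowering a later leg cancels between the
    two orders; lowering the replacement \<open>y\<close> remains.\<close>
  have 1: "(case r x of None \<Rightarrow> 0 | Some w \<Rightarrow> unshuffle_lower \<mu> (G x) (w @ xs)) + signed (snd x)
    (unshuffle_lower (\<lambda>a b. \<mu> (Suc a) b) (\<lambda>A B. case r x of None \<Rightarrow> 0 | Some w \<Rightarrow> G x (w @ A) B) xs +
     unshuffle_lower (\<lambda>a b. \<mu> a (Suc b)) (\<lambda>A B. case r x of None \<Rightarrow> 0
      | Some w \<Rightarrow> signed (Suc (snd x) * word_grade A) (G x A (w @ B))) xs) =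
    (case r x of Some [y] \<Rightarrow> if snd y = 2 then unshuffle \<mu> (M (lower y) x) xs else 0 | _ \<Rightarrow> 0)"
    
    using odd_ruleE[OF r, of x]
  proof cases
    case 1
    then show ?thesis by (simp add: unshuffle_lower_linear)
  next
    case 2
    then have "signed (Suc (snd x) * word_grade A) v = v" for A v
      by (simp add: signed_if)
    with 2 show ?thesis
      by (simp add: unshuffle_lower_harmonic[OF Cons.prems, of "G x"] signed_if del: mult_Suc)
  next
    case (3 y)
    then have "signed (Suc (snd x) * word_grade A) v = signed (snd y * word_grade A) v" for A v
      by (intro signed_cong) auto
    moreover have "signed (snd x) v = - signed (snd y) v" for v
      using 3 by (auto simp: signed_if)
    ultimately show ?thesis
      using 3 by (simp add: M_def signed_linear del: mult_Suc)
  qed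
  \<comment> \<open>The head is lowered. As \<open>lower x\<close> is odd, r acting on other legs
    cancels between the two orders, leaving r applied to \<open>lower x\<close>.\<close>
  have 2: "unshuffle \<mu> (leg_op_pair r (M (lower x))) xs +
      unshuffle \<mu> (\<lambda>A B. leg_op_pair r G (lower x # A) B -
        signed (word_grade A) (leg_op_pair r G A (lower x # B))) xs =
      (case r (lower x) of None \<Rightarrow> 0 | Some u \<Rightarrow>
        unshuffle \<mu> (\<lambda>A B. G (lower x) (u @ A) B - G (lower x) A (u @ B)) xs)"
  proof -
    have "leg_op_pair r (M (lower x)) A B + (leg_op_pair r G (lower x # A) B -
        signed (word_grade A) (leg_op_pair r G A (lower x # B))) =
      (case r (lower x) of None \<Rightarrow> 0 | Some u \<Rightarrow> G (lower x) (u @ A) B - G (lower x) A (u @ B))" for A B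
      using leg_op_pair_right[OF r, of "lower x" A G B]
      by (auto simp: leg_op_pair_left leg_op_pair_def M_def leg_op_linear signed_linear signed_if split: option.splits)
    then show ?thesis
      by (simp add: unshuffle_linear(1)[symmetric] unshuffle_linear(4) split: option.splits)
  qed
  have 3: "signed (snd x) (leg_op r (\<lambda>z ys. unshuffle_lower \<mu> (G z) (x # ys)) xs) =
      (if snd x = 2 then unshuffle \<mu> (leg_op_pair r (M (lower x))) xs else 0) +
      leg_op r (\<lambda>z. unshuffle_lower (\<lambda>a b. \<mu> (Suc a) b) (\<lambda>A B. G z (x # A) B)) xs +
      leg_op r (\<lambda>z. unshuffle_lower (\<lambda>a b. \<mu> a (Suc b))
        (\<lambda>A B. signed (snd x * word_grade A) (G z A (x # B)))) xs"
    using leg_op_unshuffle[OF r Cons.prems, of "M (lower x)" xs]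
    by (simp add: leg_op_linear signed_linear M_def) (simp add: signed_if)
  have 4: "unshuffle_lower \<mu> (leg_op_pair r G) (x # xs) =
      (if snd x = 2 then unshuffle \<mu> (\<lambda>A B. leg_op_pair r G (lower x # A) B -
        signed (word_grade A) (leg_op_pair r G A (lower x # B))) xs else 0) +
      signed (snd x)
        (unshuffle_lower (\<lambda>a b. \<mu> (Suc a) b) (\<lambda>A B. case r x of None \<Rightarrow> 0 | Some w \<Rightarrow> G x (w @ A) B) xs +
         unshuffle_lower (\<lambda>a b. \<mu> a (Suc b)) (\<lambda>A B. case r x of None \<Rightarrow> 0
          | Some w \<Rightarrow> signed (Suc (snd x) * word_grade A) (G x A (w @ B))) xs) +
      unshuffle_lower (\<lambda>a b. \<mu> (Suc a) b) (leg_op_pair r (\<lambda>z A B. G z (x # A) B)) xs +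
      unshuffle_lower (\<lambda>a b. \<mu> a (Suc b))
        (leg_op_pair r (\<lambda>z A B. signed (snd x * word_grade A) (G z A (x # B)))) xs"
    by (simp add: leg_op_pair_left[of _ _ x] leg_op_pair_right[OF r, of x] unshuffle_lower_linear signed_linear
        del: mult_Suc) (simp add: signed_if del: mult_Suc)
  \<comment> \<open>The two surviving terms exclude each other: an odd rule yields a leg of grade 2
    only from a leg of odd grade.\<close>
  have "odd (snd x)" if "r x = Some [y]" "snd y = 2" for y
    using odd_ruleD(1)[OF r that(1)] that(2) by simp
  then have 5: "(case anticommutator r x of None \<Rightarrow> 0 | Some (z, u) \<Rightarrow>
        unshuffle \<mu> (\<lambda>A B. G z (u @ A) B - signed (snd x * word_grade A) (G z A (u @ B))) xs) =
      (if snd x = 2 then case r (lower x) of None \<Rightarrow> 0 | Some u \<Rightarrow>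
        unshuffle \<mu> (\<lambda>A B. G (lower x) (u @ A) B - G (lower x) A (u @ B)) xs else 0) +
      (case r x of Some [y] \<Rightarrow> if snd y = 2 then unshuffle \<mu> (M (lower y) x) xs else 0 | _ \<Rightarrow> 0)"
    by (auto simp: anticommutator_def M_def signed_if cong: if_cong split: option.splits list.splits)
  show ?case
    unfolding unshuffle_mark.simps 5 1[symmetric] 2[symmetric] Cons.IH[OF h(1), symmetric]
      Cons.IH[OF h(2), symmetric] leg_op.simps(2) 3 4
    by (simp add: ac_simps del: mult_Suc unshuffle_lower.simps)
qed

subsection \<open>The anticommutators with the two substitution rules\<close>

lemma unshuffle_mark_zero:
  assumes "\<And>x z u. c x = Some (z, u) \<Longrightarrow> u = [] \<and> even (snd x)"
  shows "unshuffle_mark c \<mu> G xs = 0"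
proof (induction xs arbitrary: \<mu> G)
  case (Cons x xs)
  show ?case
  proof (cases "c x")
    case (Some p)
    then obtain z u where "c x = Some (z, u)"
      by (cases p) simp
    then show ?thesis
      using assms[of x z u] Cons by (simp add: unshuffle_linear signed_if)
  qed (simp add: Cons)
qed simp

text \<open>Each unmarked term is counted by the choices of its mark: \<open>a\<close> on the left,
  each with weight \<open>\<mu> (a - 1) b\<close>, and \<open>b\<close> on the right with the
  opposite sign. At \<open>a = 0\<close> the truncated difference is multiplied by 0.\<close>

lemma unshuffle_mark_all:
  assumes "\<And>x. x \<in> set xs \<Longrightarrow> \<exists>z. c x = Some (z, [x])"
  shows "unshuffle_mark c \<mu> (\<lambda>_. G) xs =
    unshuffle (\<lambda>a b. of_nat a * \<mu> (a - 1) b - of_nat b * \<mu> a (b - 1)) G xs"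
  using assms
proof (induction xs arbitrary: \<mu> G)
  case (Cons x xs)
  obtain z where z: "c x = Some (z, [x])"
    using Cons.prems[of x] by auto
  have 1: "of_nat (Suc a) * \<mu> (Suc a - 1) b - of_nat b * \<mu> (Suc a) (b - 1) =
      \<mu> a b + (of_nat a * \<mu> (Suc (a - 1)) b - of_nat b * \<mu> (Suc a) (b - 1))" for a b
    by (cases a) (simp_all add: algebra_simps)
  have 2: "of_nat a * \<mu> (a - 1) (Suc b) - of_nat (Suc b) * \<mu> a (Suc b - 1) =
      (of_nat a * \<mu> (a - 1) (Suc b) - of_nat b * \<mu> a (Suc (b - 1))) - \<mu> a b" for a b
    by (cases b) (simp_all add: algebra_simps)
  have "unshuffle (\<lambda>a b. of_nat (Suc a) * \<mu> (Suc a - 1) b - of_nat b * \<mu> (Suc a) (b - 1)) G' xs =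
      unshuffle \<mu> G' xs +
      unshuffle (\<lambda>a b. of_nat a * \<mu> (Suc (a - 1)) b - of_nat b * \<mu> (Suc a) (b - 1)) G' xs" for G'
    unfolding 1 by (rule unshuffle_weight(1))
  moreover have "unshuffle (\<lambda>a b. of_nat a * \<mu> (a - 1) (Suc b) - of_nat (Suc b) * \<mu> a (Suc b - 1)) G' xs =
      unshuffle (\<lambda>a b. of_nat a * \<mu> (a - 1) (Suc b) - of_nat b * \<mu> a (Suc (b - 1))) G' xs -
      unshuffle \<mu> G' xs" for G'
    unfolding 2 by (rule unshuffle_weight(2))
  ultimately show ?case
    unfolding unshuffle_mark.simps unshuffle.simps
    using Cons.IH[of "\<lambda>a b. \<mu> (Suc a) b"] Cons.IH[of "\<lambda>a b. \<mu> a (Suc b)"] Cons.prems z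
    by (simp add: unshuffle_linear del: of_nat_Suc diff_Suc_1)
qed simp

lemma unshuffle_left: "unshuffle (\<lambda>a b. if b = 0 then 1 else 0) G xs = G xs []"
  by (induction xs arbitrary: G) (simp_all add: unshuffle_weight)

lemma unshuffle_right: "unshuffle (\<lambda>a b. if a = 0 then 1 else 0) G xs = G [] xs"
  by (induction xs arbitrary: G) (simp_all add: unshuffle_weight)

definition beta_weight :: "nat \<Rightarrow> nat \<Rightarrow> rat" where
  "beta_weight a b = fact a * fact b / fact (Suc (a + b))"

lemma harmonic_beta_weight: "harmonic beta_weight"
  unfolding harmonic_def
proof (intro allI)
  fix a b
  have "beta_weight (Suc a) b + beta_weight a (Suc b) =
      (of_nat (Suc a) + of_nat (Suc b)) * (fact a * fact b) / (of_nat (Suc (Suc (a + b))) * fact (Suc (a + b)))"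
    unfolding beta_weight_def by (simp add: add_divide_distrib[symmetric] algebra_simps del: of_nat_Suc)
  also have "\<dots> = beta_weight a b"
    unfolding beta_weight_def by (simp add: add_divide_distrib del: of_nat_Suc fact_Suc flip: of_nat_add)
  finally show "beta_weight (Suc a) b + beta_weight a (Suc b) = beta_weight a b" .
qed

text \<open>The fundamental theorem of calculus: the left side is minus the integral of the
  derivative of (1-t)^a t^b, hence its value at t = 0 minus that at t = 1.\<close>

lemma beta_weight_boundary:
  "of_nat a * beta_weight (a - 1) b - of_nat b * beta_weight a (b - 1) =
    (if b = 0 then 1 else 0) - (if a = 0 then 1 else 0)"
  unfolding beta_weight_def by (cases a; cases b) (auto simp: algebra_simps add_nonneg_eq_0_iff)

subsection \<open>Symmetrization\<close>

fun pick :: "(leg \<Rightarrow> leg list \<Rightarrow> diagram_comb) \<Rightarrow> leg list \<Rightarrow> diagram_comb" where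
  "pick E [] = 0"
| "pick E (x # xs) = E x xs + pick (\<lambda>z ys. signed (snd x * snd z) (E z (x # ys))) xs"

text \<open>Choosing the letters from the front on yields every reordering once, and the factors
  multiply to 1/n!. The counter stands for the length, as the words produced by \<open>pick\<close>
  are not structurally smaller.\<close>

primrec symmetrize_aux :: "nat \<Rightarrow> (leg list \<Rightarrow> diagram_comb) \<Rightarrow> leg list \<Rightarrow> diagram_comb" where
  "symmetrize_aux 0 e xs = e []"
| "symmetrize_aux (Suc n) e xs =
     comb_scale (1 / of_nat (Suc n)) (pick (\<lambda>z. symmetrize_aux n (\<lambda>ys. e (z # ys))) xs)"

definition symmetrize :: "(leg list \<Rightarrow> diagram_comb) \<Rightarrow> leg list \<Rightarrow> diagram_comb" where
  "symmetrize e xs = symmetrize_aux (length xs) e xs"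

lemma combination_pick:
  "combination {(z, ys). add_mset z (mset ys) = mset xs} (\<lambda>F. pick (\<lambda>z ys. F (z, ys)) xs)"
proof (induction xs)
  case Nil
  show ?case
    by (simp add: combination_zero)
next
  case (Cons x xs)
  let ?P = "{(z, ys). add_mset z (mset ys) = mset (x # xs)}"
  have "combination ?P (\<lambda>F. pick (\<lambda>z ys. signed (snd x * snd z) (F (z, x # ys))) xs)"
    by (rule combination_bind[OF Cons, of ?P
          "\<lambda>(z, ys) F. signed (snd x * snd z) (F (z, x # ys))", unfolded split_conv])
      (auto intro!: combination_eval combination_intros simp: add_mset_commute)
  then show ?case
    by (auto intro!: combination_intros combination_eval)
qed

lemma pick_linear:
  "pick (\<lambda>z ys. E z ys + E' z ys) xs = pick E xs + pick E' xs"
  "pick (\<lambda>z ys. signed n (E z ys)) xs = signed n (pick E xs)"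
  "pick (\<lambda>z ys. comb_scale c (E z ys)) xs = comb_scale c (pick E xs)"
  using combination_linear(1)[OF combination_pick[of xs], of "case_prod E" "case_prod E'"]
    combination_linear(4)[OF combination_pick[of xs], of n "case_prod E"]
    combination_linear(3)[OF combination_pick[of xs], of c "case_prod E"]
  by (simp_all add: split_def)

lemma pick_cong:
  assumes "\<And>z ys. add_mset z (mset ys) = mset xs \<Longrightarrow> E z ys = E' z ys"
  shows "pick E xs = pick E' xs"
  using combination_cong[OF combination_pick[of xs], of "case_prod E" "case_prod E'"] assms
  by (auto simp: split_def)

lemma pick_cong_length:
  assumes "\<And>z ys. Suc (length ys) = length xs \<Longrightarrow> E z ys = E' z ys"
  shows "pick E xs = pick E' xs"
  by (rule pick_cong) (metis assms size_add_mset size_mset)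

lemma combination_symmetrize_aux:
  "n = length xs \<Longrightarrow> combination {ys. mset ys = mset xs} (\<lambda>e. symmetrize_aux n e xs)"
proof (induction n arbitrary: xs)
  case 0
  then show ?case
    by (auto intro!: combination_eval)
next
  case (Suc n)
  have "combination {ys. mset ys = mset xs} (\<lambda>e. pick (\<lambda>z zs. symmetrize_aux n (\<lambda>ys. e (z # ys)) zs) xs)"
  proof (rule combination_bind[OF combination_pick, of xs _
        "\<lambda>(z, zs) e. symmetrize_aux n (\<lambda>ys. e (z # ys)) zs", unfolded split_conv], clarsimp)
    fix h g zs
    assume m: "add_mset (h, g) (mset zs) = mset xs"
    then have "n = length zs"
      using Suc.prems by (metis Suc_inject size_add_mset size_mset)
    then show "combination {ys. mset ys = mset xs} (\<lambda>e. symmetrize_aux n (\<lambda>ys. e ((h, g) # ys)) zs)"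
      by (intro combination_bind[OF Suc.IH, of zs _ "\<lambda>ys e. e ((h, g) # ys)"])
        (auto intro!: combination_eval simp: m)
  qed
  then show ?case
    by (simp add: combination_scale)
qed

lemma combination_symmetrize: "combination {ys. mset ys = mset xs} (\<lambda>e. symmetrize e xs)"
  unfolding symmetrize_def by (rule combination_symmetrize_aux) simp

lemma symmetrize_aux_linear:
  assumes "n = length xs"
  shows "symmetrize_aux n (\<lambda>ys. e ys + e' ys) xs = symmetrize_aux n e xs + symmetrize_aux n e' xs"
    and "symmetrize_aux n (\<lambda>ys. signed k (e ys)) xs = signed k (symmetrize_aux n e xs)"
    and "symmetrize_aux n (\<lambda>ys. 0) xs = 0"
  using combination_linear[OF combination_symmetrize_aux[OF assms]] by metis+

text \<open>r acts on the picked letter or on the others. A letter that r has removed cannot be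
  picked, so \<open>Some []\<close> contributes nothing to the first term.\<close>

lemma leg_op_pick:
  assumes r: "odd_rule r"
  shows "leg_op r (\<lambda>z. pick (E z)) xs =
    pick (\<lambda>z ys. (case r z of Some [y] \<Rightarrow> E z y ys | _ \<Rightarrow> 0) + signed (snd z) (leg_op r (\<lambda>z'. E z' z) ys)) xs"
proof (induction xs arbitrary: E)
  case (Cons x xs)
  define R where "R = (\<lambda>E z (ys :: leg list). case r z of Some [y] \<Rightarrow> E z y ys | _ \<Rightarrow> (0 :: diagram_comb))"
  define W where "W = (\<lambda>z ys. case r x of None \<Rightarrow> 0 | Some w \<Rightarrow> E x z (w @ ys))"
  have 1: "(case r x of None \<Rightarrow> 0 | Some w \<Rightarrow> pick (E x) (w @ xs)) =
      R E x xs + pick (\<lambda>z ys. signed (snd x * snd z + snd z) (W z ys)) xs"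
    using odd_ruleE[OF r, of x]
  proof cases
    case 1
    then show ?thesis by (simp add: R_def W_def pick_linear(3)[of 0, simplified])
  next
    case 2
    then have "signed (snd x * snd z + snd z) v = v" for z :: leg and v
      by (simp add: signed_if)
    with 2 show ?thesis
      by (simp add: R_def W_def)
  next
    case (3 y)
    then have "signed (snd x * snd z + snd z) v = signed (snd y * snd z) v" for z :: leg and v
      by (intro signed_cong) auto
    with 3 show ?thesis
      by (simp add: R_def W_def)
  qed
  \<comment> \<open>The replacement of \<open>z\<close> has the opposite parity, so moving it past
    \<open>x\<close> instead of \<open>z\<close> is compensated by the sign of carrying r past
    \<open>x\<close>.\<close>
  have 2: "signed (snd x) (R (\<lambda>z' z ys. signed (snd x * snd z) (E z' z (x # ys))) z ys) =
      signed (snd x * snd z) (R (\<lambda>z' z ys. E z' z (x # ys)) z ys)" for z ys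
    using odd_ruleE[OF r, of z]
  proof cases
    case (3 y)
    then have "signed (snd x + snd x * snd y) v = signed (snd x * snd z) v" for v
      by (intro signed_cong) auto
    with 3 show ?thesis
      by (simp add: R_def)
  qed (simp_all add: R_def)
  have 3: "R E z (x # ys) = R (\<lambda>z' z ys. E z' z (x # ys)) z ys" for z ys
    by (simp add: R_def)
  have "leg_op r (\<lambda>z. pick (E z)) (x # xs) =
      R E x xs + pick (\<lambda>z ys. signed (snd x * snd z + snd z) (W z ys)) xs +
      signed (snd x) (leg_op r (\<lambda>z. E z x) xs +
        pick (\<lambda>z ys. R (\<lambda>z' z ys. signed (snd x * snd z) (E z' z (x # ys))) z ys +
          signed (snd z) (leg_op r (\<lambda>z' ys. signed (snd x * snd z) (E z' z (x # ys))) ys)) xs)"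
    using Cons[of "\<lambda>z' z ys. signed (snd x * snd z) (E z' z (x # ys))"]
    by (simp add: 1 R_def leg_op_linear)
  also have "\<dots> = pick (\<lambda>z ys. R E z ys + signed (snd z) (leg_op r (\<lambda>z'. E z' z) ys)) (x # xs)"
    by (simp add: 3 2 W_def signed_linear pick_linear(1) pick_linear(2)[symmetric] leg_op_linear)
      (simp add: ac_simps)
  finally show ?case
    by (simp add: R_def)
qed simp

text \<open>The letters that r removes have odd grade, so moving one to the front past
  \<open>x\<close> costs the same sign as carrying r past \<open>x\<close>.\<close>

lemma pick_odd:
  assumes "odd_rule r" "\<And>x w. r x = Some w \<Longrightarrow> w = []"
  shows "pick (\<lambda>z ys. case r z of None \<Rightarrow> 0 | Some w \<Rightarrow> E z ys) xs = leg_op r E xs"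
proof (induction xs arbitrary: E)
  case (Cons x xs)
  have "signed (snd x * snd z) (case r z of None \<Rightarrow> 0 | Some w \<Rightarrow> E z (x # ys)) =
      (case r z of None \<Rightarrow> 0 | Some w \<Rightarrow> signed (snd x) (E z (x # ys)))" for z ys
    using odd_ruleE[OF assms(1), of z] assms(2)[of z] by cases (auto simp: signed_if)
  then show ?case
    using assms(2)[of x] Cons[of "\<lambda>z ys. signed (snd x) (E z (x # ys))"]
    by (auto simp: leg_op_linear split: option.splits)
qed simp

lemma leg_op_symmetrize_preserving:
  assumes r: "odd_rule r" "\<And>x w. r x = Some w \<Longrightarrow> length w = 1" and "n = length xs"
  shows "leg_op r (\<lambda>z. symmetrize_aux n (G z)) xs = symmetrize_aux n (leg_op r G) xs"
  using assms(3)
proof (induction n arbitrary: xs G)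
  case (Suc n)
  have "(case r z of Some [y] \<Rightarrow> symmetrize_aux n (\<lambda>w. G z (y # w)) ys | _ \<Rightarrow> 0) +
      signed (snd z) (leg_op r (\<lambda>z'. symmetrize_aux n (\<lambda>w. G z' (z # w))) ys) =
    symmetrize_aux n (\<lambda>w. leg_op r G (z # w)) ys" if "Suc (length ys) = length xs" for z ys
  proof -
    have n: "n = length ys"
      using that Suc.prems by simp
    show ?thesis
      using odd_ruleE[OF r(1), of z] r(2)[of z]
      by cases (simp_all add: symmetrize_aux_linear[OF n] Suc.IH[OF n])
  qed
  then show ?case
    by (auto simp: leg_op_linear(3) leg_op_pick[OF r(1)] intro!: arg_cong[of _ _ "comb_scale _"] pick_cong_length)
qed simp

text \<open>
  The first letter of a symmetrized word of length \<open>n + 1\<close> is removed in a fraction \<open>1 / (n + 1)\<close> of the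
  terms, which accounts for the change of normalization from \<open>n!\<close> to \<open>(n + 1)!\<close>.
\<close>

lemma leg_op_symmetrize_removing:
  assumes r: "odd_rule r" "\<And>x w. r x = Some w \<Longrightarrow> w = []" and "length xs = Suc n"
  shows "leg_op r (\<lambda>z. symmetrize_aux n (G z)) xs = symmetrize_aux (Suc n) (leg_op r G) xs"
  using assms(3)
proof (induction n arbitrary: xs G)
  case 0
  then obtain x where "xs = [x]"
    by (auto simp: length_Suc_conv)
  then show ?case
    using r(2)[of x] by (auto split: option.splits)
next
  case (Suc n)
  define D where "D = leg_op r (\<lambda>z. symmetrize_aux (Suc n) (G z)) xs"
  define Q where "Q = pick (\<lambda>z ys. signed (snd z) (leg_op r (\<lambda>z'. symmetrize_aux n (\<lambda>w. G z' (z # w))) ys)) xs"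
  have [simp]: "(case r z of Some [y] \<Rightarrow> E y | _ \<Rightarrow> 0) = 0" for z and E :: "leg \<Rightarrow> diagram_comb"
    using r(2)[of z] by (auto split: option.splits)
  have D: "D = comb_scale (1 / of_nat (Suc n)) Q"
    unfolding D_def Q_def symmetrize_aux.simps leg_op_linear(3) leg_op_pick[OF r(1)] by simp
  \<comment> \<open>Removing the front letter gives \<open>D\<close>, by \<open>pick_odd\<close>;
    removing a later one gives \<open>Q\<close>, which is n+1 times \<open>D\<close>.\<close>
  have "pick (\<lambda>z. symmetrize_aux (Suc n) (\<lambda>w. leg_op r G (z # w))) xs =
    pick (\<lambda>z ys. (case r z of None \<Rightarrow> 0 | Some _ \<Rightarrow> symmetrize_aux (Suc n) (G z) ys) +
      signed (snd z) (leg_op r (\<lambda>z'. symmetrize_aux n (\<lambda>w. G z' (z # w))) ys)) xs"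
  proof (rule pick_cong_length)
    fix z and ys :: "leg list"
    assume "Suc (length ys) = length xs"
    then have n: "length ys = Suc n"
      using Suc.prems by simp
    have "(case r z of None \<Rightarrow> 0 | Some w \<Rightarrow> G z (w @ ys)) = (case r z of None \<Rightarrow> 0 | Some w \<Rightarrow> G z ys)" for ys
      using r(2)[of z] by (auto split: option.splits)
    then show "symmetrize_aux (Suc n) (\<lambda>w. leg_op r G (z # w)) ys =
      (case r z of None \<Rightarrow> 0 | Some _ \<Rightarrow> symmetrize_aux (Suc n) (G z) ys) +
      signed (snd z) (leg_op r (\<lambda>z'. symmetrize_aux n (\<lambda>w. G z' (z # w))) ys)"
      unfolding leg_op.simps Suc.IH[OF n]
      by (simp only: symmetrize_aux_linear[OF n[symmetric]])
        (cases "r z"; simp add: symmetrize_aux_linear(3)[OF n[symmetric]] del: symmetrize_aux.simps)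
  qed
  also have "\<dots> = D + Q"
    unfolding pick_linear(1) Q_def D_def using pick_odd[OF r(1), where xs = xs] r(2)
    by (simp del: symmetrize_aux.simps)
  finally have "symmetrize_aux (Suc (Suc n)) (leg_op r G) xs = comb_scale (1 / of_nat (Suc (Suc n))) (D + Q)"
    by (simp only: symmetrize_aux.simps(2)[of "Suc n"])
  also have "Q = comb_scale (of_nat (Suc n)) D"
    by (simp add: D del: of_nat_Suc)
  also have "D + \<dots> = comb_scale (of_nat (Suc (Suc n))) D"
    by (simp only: of_nat_Suc[of "Suc n"] comb.scale_left_distrib comb.scale_one)
  finally show ?case
    by (simp add: D_def del: of_nat_Suc symmetrize_aux.simps)
qed

lemma leg_op_cong:
  assumes "\<And>z ys w. r z = Some w \<Longrightarrow> Suc (length ys) = length xs + length w \<Longrightarrow> E z ys = E' z ys"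
  shows "leg_op r E xs = leg_op r E' xs"
  unfolding leg_op_conv_sum by (intro sum.cong refl arg_cong[of _ _ "signed _"])
    (auto intro!: assms split: option.splits)

lemma leg_op_symmetrize:
  assumes r: "odd_rule r"
  shows "leg_op r (\<lambda>z. symmetrize (G z)) xs = symmetrize (leg_op r G) xs"
proof (cases xs)
  case Nil
  then show ?thesis
    by (simp add: symmetrize_def)
next
  case (Cons x xs')
  \<comment> \<open>The normalization depends on the length of the resulting word, so the legs that
    r removes are separated from those it replaces.\<close>
  define r0 where "r0 = (\<lambda>x. if r x = Some [] then Some [] else None :: leg list option)"
  define r1 where "r1 = (\<lambda>x. if r x = Some [] then None else r x)"
  have split: "leg_op r E ys = leg_op r0 E ys + leg_op r1 E ys" for E ys
    by (induction ys arbitrary: E) (auto simp: r0_def r1_def signed_linear split: option.splits)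
  have 0: "odd_rule r0" and 1: "odd_rule r1"
    using r by (auto simp: odd_rule_def r0_def r1_def)
  have r0: "w = []" if "r0 x = Some w" for x w
    using that by (auto simp: r0_def split: if_splits)
  have r1: "length w = 1" if "r1 x = Some w" for x w
    using odd_ruleD(2)[OF r, of x w] that by (cases w) (auto simp: r1_def split: if_splits)
  have n: "length xs = Suc (length xs')"
    by (simp add: Cons)
  have "leg_op r0 (\<lambda>z. symmetrize (G z)) xs = leg_op r0 (\<lambda>z. symmetrize_aux (length xs') (G z)) xs"
    by (intro leg_op_cong) (auto simp: symmetrize_def n dest!: r0)
  moreover have "leg_op r1 (\<lambda>z. symmetrize (G z)) xs = leg_op r1 (\<lambda>z. symmetrize_aux (length xs) (G z)) xs"
    by (intro leg_op_cong) (auto simp: symmetrize_def dest!: r1)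
  ultimately have "leg_op r (\<lambda>z. symmetrize (G z)) xs = symmetrize (leg_op r0 G) xs + symmetrize (leg_op r1 G) xs"
    using leg_op_symmetrize_preserving[OF 1 _ refl, of xs G] r1
      leg_op_symmetrize_removing[OF 0 _ n, of G] r0
    by (simp add: split symmetrize_def n del: symmetrize_aux.simps)
  also have "\<dots> = symmetrize (leg_op r G) xs"
    unfolding split[abs_def] by (rule combination_linear(1)[OF combination_symmetrize, symmetric])
  finally show ?thesis .
qed

subsection \<open>The homotopy on words\<close>

definition homotopy :: "(leg list \<Rightarrow> diagram_comb) \<Rightarrow> leg list \<Rightarrow> diagram_comb" where
  "homotopy e = unshuffle_lower beta_weight (\<lambda>A. symmetrize (\<lambda>B. e (A @ B)))"

text \<open>Symmetrizing the right factor and concatenating are compatible with r, so the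
  anticommutator computed on pairs of words carries over.\<close>

lemma leg_op_homotopy:
  assumes r: "odd_rule r"
  shows "leg_op r (\<lambda>z. homotopy (E z)) xs + homotopy (leg_op r E) xs =
    unshuffle_mark (anticommutator r) beta_weight (\<lambda>z A. symmetrize (\<lambda>B. E z (A @ B))) xs"
proof -
  have "(\<lambda>A. symmetrize (\<lambda>C. leg_op r E (A @ C))) = leg_op_pair r (\<lambda>z A. symmetrize (\<lambda>C. E z (A @ C)))"
  proof (intro ext)
    fix A B
    have "symmetrize (\<lambda>C. leg_op r (\<lambda>z A'. E z (A' @ C)) A) B =
        leg_op r (\<lambda>z A'. symmetrize (\<lambda>C. E z (A' @ C)) B) A"
      using combination_exchange[OF combination_symmetrize[of B] combination_leg_op[of r A],
          of "\<lambda>C (z, A'). E z (A' @ C)"] by simp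
    moreover have "symmetrize (\<lambda>C. signed (word_grade A) (leg_op r (\<lambda>z B'. E z (A @ B')) C)) B =
        signed (word_grade A) (leg_op r (\<lambda>z. symmetrize (\<lambda>C. E z (A @ C))) B)"
      by (simp add: combination_linear(4)[OF combination_symmetrize] leg_op_symmetrize[OF r])
    ultimately show "symmetrize (\<lambda>C. leg_op r E (A @ C)) B =
        leg_op_pair r (\<lambda>z A. symmetrize (\<lambda>C. E z (A @ C))) A B"
      unfolding leg_op_append leg_op_pair_def by (simp add: combination_linear(1)[OF combination_symmetrize])
  qed
  then show ?thesis
    using leg_op_unshuffle_lower[OF r harmonic_beta_weight, of "\<lambda>z A. symmetrize (\<lambda>B. E z (A @ B))" xs]
    by (simp add: homotopy_def)
qed

definition d_rule :: "leg \<Rightarrow> leg list option" where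
  "d_rule x = (if snd x = 1 then Some [(fst x, 2)] else None)"

definition iota_rule :: "nat \<Rightarrow> leg \<Rightarrow> leg list option" where
  "iota_rule m x = (if snd x = 1 then Some [] else if snd x = 2 then Some [(m, 1)] else None)"

lemma odd_rules: "odd_rule d_rule" "odd_rule (iota_rule m)"
  by (simp_all add: odd_rule_def d_rule_def iota_rule_def)

text \<open>\<open>d\<close> and lowering are mutually inverse between grades 1 and 2, so every leg
  is marked and reproduced. Of the two boundary weights, the one at t = 0 keeps the word and the one
  at t = 1 symmetrizes it.\<close>

lemma d_homotopy:
  assumes "snd ` set xs \<subseteq> {1, 2}"
  shows "leg_op d_rule (\<lambda>_. homotopy e) xs + homotopy (leg_op d_rule (\<lambda>_. e)) xs = e xs - symmetrize e xs"
proof -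
  have "\<exists>z. anticommutator d_rule x = Some (z, [x])" if "x \<in> set xs" for x
    using assms that by (cases x) (auto simp: anticommutator_def d_rule_def)
  then show ?thesis
    unfolding leg_op_homotopy[OF odd_rules(1)]
    by (simp only: unshuffle_mark_all beta_weight_boundary unshuffle_weight(2) unshuffle_left unshuffle_right)
      (simp add: symmetrize_def)
qed

text \<open>On a single leg, only lowering a leg of grade 2 followed by \<iota> is nonzero. It
  removes the leg, with the same result in either factor, and left minus right cancels.\<close>

lemma iota_homotopy:
  "leg_op (iota_rule m) (\<lambda>z. homotopy (E z)) xs + homotopy (leg_op (iota_rule m) E) xs = 0"
  unfolding leg_op_homotopy[OF odd_rules(2)]
  by (rule unshuffle_mark_zero) (auto simp: anticommutator_def iota_rule_def split: if_splits option.splits list.splits)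

section \<open>Comparison with averaging over permutations\<close>

fun inversion_sign :: "(nat \<Rightarrow> nat) \<Rightarrow> nat list \<Rightarrow> rat" where
  "inversion_sign g [] = 1"
| "inversion_sign g (p # ps) =
     (\<Prod>q\<in>set ps. if q < p then (-1) ^ (g p * g q) else 1) * inversion_sign g ps"

text \<open>The recursive sign follows the choice of the first letter; splitting the pairs by
  whether \<open>i = 0\<close> matches it with the inversions in \<open>koszul_sign\<close>.\<close>

lemma inversion_sign_conv_prod:
  assumes "distinct ps"
  shows "inversion_sign g ps = (\<Prod>(i, j)\<in>{(i, j). i < j \<and> j < length ps}.
    if ps ! j < ps ! i then (-1) ^ (g (ps ! i) * g (ps ! j)) else 1)"
  using assms
proof (induction ps)
  case Nil
  have "{(i, j). i < j \<and> j < length ([] :: nat list)} = {}"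
    by auto
  then show ?case
    by (simp only: inversion_sign.simps prod.empty)
next
  case (Cons p ps)
  define F where "F = (\<lambda>qs (i, j). if qs ! j < qs ! i then (-1) ^ (g (qs ! i) * g (qs ! j)) else 1 :: rat)"
  let ?P = "\<lambda>n. {(i, j). i < j \<and> j < n}"
  have fin: "finite (?P n)" for n :: nat
    by (rule finite_subset[of _ "{..<n} \<times> {..<n}"]) auto
  have "?P (length (p # ps)) = Pair 0 ` Suc ` {..<length ps} \<union> map_prod Suc Suc ` ?P (length ps)" (is "_ = ?A \<union> ?B")
  proof (rule set_eqI, clarify)
    fix i j
    show "(i, j) \<in> ?P (length (p # ps)) \<longleftrightarrow> (i, j) \<in> ?A \<union> ?B"
      by (cases i; cases j) (auto simp: image_iff)
  qed
  then have "prod (F (p # ps)) (?P (length (p # ps))) = prod (F (p # ps)) ?A * prod (F (p # ps)) ?B"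
    using fin by (simp only:) (rule prod.union_disjoint, auto)
  also have "prod (F (p # ps)) ?A = (\<Prod>j<length ps. if ps ! j < p then (-1) ^ (g p * g (ps ! j)) else 1)"
    by (auto simp: prod.reindex inj_on_def F_def intro!: prod.cong)
  also have "\<dots> = (\<Prod>q\<in>set ps. if q < p then (-1) ^ (g p * g q) else 1)"
    using Cons.prems by (intro prod.reindex_bij_betw bij_betw_nth) auto
  also have "prod (F (p # ps)) ?B = prod (F ps) (?P (length ps))"
    by (subst prod.reindex) (auto simp: inj_on_def F_def intro!: prod.cong)
  also have "\<dots> = inversion_sign g ps"
    using Cons by (simp add: F_def)
  finally show ?case
    by (simp add: F_def)
qed

text \<open>Letters are labelled by their original positions. As \<open>is\<close> is increasing, a
  letter moving to the front passes exactly those with smaller labels, and its removal keeps the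
  list increasing.\<close>

lemma pick_map_sorted:
  fixes f :: "nat \<Rightarrow> leg"
  assumes "sorted_wrt (<) is"
  shows "pick E (map f is) = (\<Sum>p\<in>set is.
    comb_scale (\<Prod>q\<in>set is - {p}. if q < p then (-1) ^ (snd (f p) * snd (f q)) else 1)
      (E (f p) (map f (remove1 p is))))"
  using assms
proof (induction "is" arbitrary: E)
  case (Cons i "is")
  define c :: "nat set \<Rightarrow> nat \<Rightarrow> rat"
    where "c = (\<lambda>A p. \<Prod>q\<in>A. if q < p then (-1) ^ (snd (f p) * snd (f q)) else 1)"
  have i: "i < p" "p \<noteq> i" if "p \<in> set is" for p
    using Cons.prems that by auto
  then have notin: "i \<notin> set is"
    by blast
  have "c (set is) i = 1"
    unfolding c_def by (intro prod.neutral) (auto dest: i(1))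
  then have 1: "c (insert i (set is) - {i}) i = 1"
    using notin by simp
  have 2: "c (insert i (set is) - {p}) p = (-1) ^ (snd (f p) * snd (f i)) * c (set is - {p}) p"
    if "p \<in> set is" for p
  proof -
    have "insert i (set is) - {p} = insert i (set is - {p})"
      using i[OF that] by auto
    then show ?thesis
      unfolding c_def using notin i[OF that] by simp
  qed
  have "pick E (map f (i # is)) = E (f i) (map f is) + (\<Sum>p\<in>set is. comb_scale (c (set is - {p}) p)
      (signed (snd (f i) * snd (f p)) (E (f p) (f i # map f (remove1 p is)))))"
    using Cons by (simp add: c_def)
  also have "\<dots> = (\<Sum>p\<in>set (i # is). comb_scale (c (set (i # is) - {p}) p) (E (f p) (map f (remove1 p (i # is)))))"
    using notin 1 i(2)[symmetric] by (auto simp: 2 signed_def mult.commute intro!: sum.cong)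
  finally show ?case
    by (simp add: c_def)
qed simp

lemma symmetrize_aux_map_sorted:
  fixes f :: "nat \<Rightarrow> leg"
  assumes "sorted_wrt (<) is" "length is = n"
  shows "symmetrize_aux n e (map f is) = comb_scale (1 / fact n)
    (\<Sum>ps\<in>permutations_of_set (set is). comb_scale (inversion_sign (\<lambda>p. snd (f p)) ps) (e (map f ps)))"
  using assms
proof (induction n arbitrary: "is" e)
  case (Suc n)
  define S where "S = set is"
  define c :: "nat set \<Rightarrow> nat \<Rightarrow> rat"
    where "c = (\<lambda>A p. \<Prod>q\<in>A. if q < p then (-1) ^ (snd (f p) * snd (f q)) else 1)"
  define T where "T = (\<lambda>ps. comb_scale (inversion_sign (\<lambda>p. snd (f p)) ps) (e (map f ps)))"
  have dist: "distinct is"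
    using Suc.prems(1) by (simp add: strict_sorted_iff)
  have IH: "symmetrize_aux n (\<lambda>ys. e (f p # ys)) (map f (remove1 p is)) = comb_scale (1 / fact n)
      (\<Sum>ps\<in>permutations_of_set (S - {p}). comb_scale (inversion_sign (\<lambda>p. snd (f p)) ps) (e (f p # map f ps)))"
    if "p \<in> set is" for p
    using Suc.IH[of "remove1 p is" "\<lambda>ys. e (f p # ys)"] Suc.prems that dist
    by (simp add: strict_sorted_iff sorted_remove1 length_remove1 S_def)
  have "symmetrize_aux (Suc n) e (map f is) = comb_scale (1 / of_nat (Suc n)) (\<Sum>p\<in>S.
      comb_scale (c (S - {p}) p) (comb_scale (1 / fact n) (\<Sum>ps\<in>permutations_of_set (S - {p}).
        comb_scale (inversion_sign (\<lambda>p. snd (f p)) ps) (e (f p # map f ps)))))"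
    unfolding symmetrize_aux.simps pick_map_sorted[OF Suc.prems(1)] c_def S_def[symmetric]
    by (intro arg_cong[of _ _ "comb_scale _"] sum.cong refl) (simp add: IH S_def)
  also have "\<dots> = comb_scale (1 / fact (Suc n)) (\<Sum>p\<in>S. \<Sum>ps\<in>permutations_of_set (S - {p}). T (p # ps))"
    unfolding T_def c_def
    by (simp add: comb.scale_sum_right permutations_of_setD mult_ac)
  also have "(\<Sum>p\<in>S. \<Sum>ps\<in>permutations_of_set (S - {p}). T (p # ps)) = (\<Sum>ps\<in>permutations_of_set S. T ps)"
  proof -
    have "S \<noteq> {}" "finite S"
      using Suc.prems(2) by (auto simp: S_def)
    then have "(\<Sum>ps\<in>permutations_of_set S. T ps) = (\<Sum>p\<in>S. sum T ((#) p ` permutations_of_set (S - {p})))"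
      unfolding permutations_of_set_nonempty[OF \<open>S \<noteq> {}\<close>] by (intro sum.UNION_disjoint) auto
    then show ?thesis
      by (simp add: sum.reindex)
  qed
  finally show ?case
    by (simp add: S_def T_def)
qed simp

lemma average_diagram_conv_symmetrize:
  "average_diagram D = symmetrize (\<lambda>ls. diagram_vec (D\<lparr>legs := ls\<rparr>)) (legs D)"
proof -
  define n where "n = length (legs D)"
  define gs where "gs = map snd (legs D)"
  have map_perm: "map \<pi> [0..<n] \<in> permutations_of_set {..<n}" if "\<pi> permutes {..<n}" for \<pi>
    using permutes_image[OF that] permutes_inj_on[OF that]
    by (auto simp: permutations_of_set_def distinct_map lessThan_atLeast0)
  have sign: "koszul_sign gs \<pi> = inversion_sign (\<lambda>p. snd (legs D ! p)) (map \<pi> [0..<n])"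
    if "\<pi> permutes {..<n}" for \<pi>
  proof -
    have "\<pi> i < n" if "i < n" for i
      using permutes_in_image[OF \<open>\<pi> permutes {..<n}\<close>] that by simp
    then show ?thesis
      using map_perm[OF that]
      by (subst inversion_sign_conv_prod)
        (auto simp: permutations_of_set_def koszul_sign_alt gs_def n_def intro!: prod.cong)
  qed
  have "average_diagram D = (\<Sum>\<pi> | \<pi> permutes {..<n}. comb_scale (koszul_sign gs \<pi> / fact n)
      (diagram_vec (D\<lparr>legs := permute_list \<pi> (legs D)\<rparr>)))"
    by (simp add: average_diagram_def n_def gs_def)
  also have "\<dots> = (\<Sum>ps\<in>permutations_of_set {..<n}. comb_scale (1 / fact n)
      (comb_scale (inversion_sign (\<lambda>p. snd (legs D ! p)) ps) (diagram_vec (D\<lparr>legs := map ((!) (legs D)) ps\<rparr>))))"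
  \<comment> \<open>A permutation corresponds to the list of its values; \<open>permutes\<close>
    demands the identity outside \<open>{..<n}\<close>, hence the default \<open>i\<close>.\<close>
  proof (rule sum.reindex_bij_witness[where j = "\<lambda>\<pi>. map \<pi> [0..<n]" and i = "\<lambda>ps i. if i < n then ps ! i else i"])
    fix \<pi> :: "nat \<Rightarrow> nat"
    assume "\<pi> \<in> {\<pi>. \<pi> permutes {..<n}}"
    then have \<pi>: "\<pi> permutes {..<n}"
      by simp
    show "(\<lambda>i. if i < n then map \<pi> [0..<n] ! i else i) = \<pi>"
      using permutes_not_in[OF \<pi>] by (auto simp: fun_eq_iff)
    show "map \<pi> [0..<n] \<in> permutations_of_set {..<n}"
      by (rule map_perm[OF \<pi>])
    show "comb_scale (1 / fact n) (comb_scale (inversion_sign (\<lambda>p. snd (legs D ! p)) (map \<pi> [0..<n]))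
        (diagram_vec (D\<lparr>legs := map ((!) (legs D)) (map \<pi> [0..<n])\<rparr>))) =
      comb_scale (koszul_sign gs \<pi> / fact n) (diagram_vec (D\<lparr>legs := permute_list \<pi> (legs D)\<rparr>))"
      by (simp add: sign[OF \<pi>] permute_list_def n_def o_def)
  next
    fix ps
    assume "ps \<in> permutations_of_set {..<n}"
    then have ps: "set ps = {..<n}" "distinct ps"
      by (auto simp: permutations_of_set_def)
    then have len: "length ps = n"
      using distinct_card by fastforce
    show "map (\<lambda>i. if i < n then ps ! i else i) [0..<n] = ps"
      by (rule nth_equalityI) (simp_all add: len)
    have "bij_betw ((!) ps) {..<n} {..<n}"
      using bij_betw_nth[OF ps(2)] ps(1) len by simp
    then have "bij_betw (\<lambda>i. if i < n then ps ! i else i) {..<n} {..<n}"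
      by (subst bij_betw_cong[where g = "(!) ps"]) simp_all
    then show "(\<lambda>i. if i < n then ps ! i else i) \<in> {\<pi>. \<pi> permutes {..<n}}"
      by (intro CollectI bij_imp_permutes) auto
  qed
  also have "\<dots> = symmetrize (\<lambda>ls. diagram_vec (D\<lparr>legs := ls\<rparr>)) (legs D)"
    using symmetrize_aux_map_sorted[of "[0..<n]" n "\<lambda>ls. diagram_vec (D\<lparr>legs := ls\<rparr>)" "(!) (legs D)"]
    by (simp add: symmetrize_def n_def map_nth comb.scale_sum_right lessThan_atLeast0)
  finally show ?thesis .
qed

section \<open>The homotopy on diagrams\<close>

lemma combination_homotopy:
  "combination {ls. \<exists>x\<in>#mset xs. snd x = 2 \<and> add_mset x (mset ls) = add_mset (lower x) (mset xs)}
    (\<lambda>e. homotopy e xs)"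
  unfolding homotopy_def
proof (rule combination_bind[OF combination_unshuffle_lower, of xs _
      "\<lambda>(A, B) e. symmetrize (\<lambda>C. e (A @ C)) B" beta_weight, unfolded split_conv], clarify)
  fix A B h g
  assume AB: "(h, g) \<in># mset xs" "snd (h, g) = 2"
    "add_mset (h, g) (mset A + mset B) = add_mset (lower (h, g)) (mset xs)"
  show "combination {ls. \<exists>x\<in>#mset xs. snd x = 2 \<and> add_mset x (mset ls) = add_mset (lower x) (mset xs)}
      (\<lambda>e. symmetrize (\<lambda>C. e (A @ C)) B)"
    by (rule combination_bind[OF combination_symmetrize, of B _ "\<lambda>C e. e (A @ C)"], rule combination_eval,
        rule CollectI, rule bexI[of _ "(h, g)"]) (use AB in auto)
qed

section \<open>Naturality in the half-edges and validity of leg lists\<close>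

lemma word_grade_map [simp]: "word_grade (map (map_prod \<phi> id) xs) = word_grade xs"
  by (induction xs) auto

lemma unshuffle_map:
  "unshuffle \<mu> G (map (map_prod \<phi> id) xs) =
    unshuffle \<mu> (\<lambda>A B. G (map (map_prod \<phi> id) A) (map (map_prod \<phi> id) B)) xs"
  by (induction xs arbitrary: \<mu> G) (simp_all del: map_map)

lemma unshuffle_lower_map:
  "unshuffle_lower \<mu> G (map (map_prod \<phi> id) xs) =
    unshuffle_lower \<mu> (\<lambda>A B. G (map (map_prod \<phi> id) A) (map (map_prod \<phi> id) B)) xs"
  by (induction xs arbitrary: \<mu> G) (simp_all add: unshuffle_map del: map_map)

lemma pick_map:
  "pick E (map (map_prod \<phi> id) xs) = pick (\<lambda>z ys. E (map_prod \<phi> id z) (map (map_prod \<phi> id) ys)) xs"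
  by (induction xs arbitrary: E) simp_all

lemma symmetrize_map:
  "symmetrize e (map (map_prod \<phi> id) xs) = symmetrize (\<lambda>ys. e (map (map_prod \<phi> id) ys)) xs"
proof -
  have "symmetrize_aux n e (map (map_prod \<phi> id) xs) = symmetrize_aux n (\<lambda>ys. e (map (map_prod \<phi> id) ys)) xs" for n
    by (induction n arbitrary: e xs) (simp_all add: pick_map)
  then show ?thesis
    by (simp add: symmetrize_def)
qed

lemma homotopy_map:
  "homotopy e (map (map_prod \<phi> id) xs) = homotopy (\<lambda>ys. e (map (map_prod \<phi> id) ys)) xs"
  by (simp add: homotopy_def unshuffle_lower_map symmetrize_map)

lemma weil_diagram_lower:
  assumes D: "weil_diagram D" and x: "x \<in># mset (legs D)" "snd x = 2"
    and ls: "add_mset x (mset ls) = add_mset (lower x) (mset (legs D))"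
  shows "weil_diagram (D\<lparr>legs := ls\<rparr>)" "Suc (word_grade ls) = leg_grade D"
proof -
  have "image_mset fst (add_mset x (mset ls)) = image_mset fst (add_mset (lower x) (mset (legs D)))"
    by (simp only: ls)
  then have fst: "mset (map fst ls) = mset (map fst (legs D))"
    by simp
  have "distinct (map fst ls)" "fst ` set ls = fst ` set (legs D)"
    using mset_eq_imp_distinct_iff[OF fst] mset_eq_setD[OF fst] weil_diagramD(7)[OF D] by auto
  moreover have "set ls \<subseteq> insert (lower x) (set (legs D))"
    using arg_cong[OF ls, of set_mset] by auto
  then have "snd ` set ls \<subseteq> {1, 2}"
    using weil_diagramD(8)[OF D] by fastforce
  ultimately show "weil_diagram (D\<lparr>legs := ls\<rparr>)"
    using D by (simp add: weil_diagram_def)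
  have "sum_mset (image_mset snd (add_mset x (mset ls))) = sum_mset (image_mset snd (add_mset (lower x) (mset (legs D))))"
    by (simp only: ls)
  then show "Suc (word_grade ls) = leg_grade D"
    using x(2) by (simp add: leg_grade_def sum_mset_sum_list flip: mset_map)
qed

definition homotopy_diagram :: "diagram \<Rightarrow> diagram_comb" where
  "homotopy_diagram D = homotopy (\<lambda>ls. diagram_vec (D\<lparr>legs := ls\<rparr>)) (legs D)"

lemma homotopy_diagram_cong:
  assumes "weil_diagram D" "\<And>ls. weil_diagram (D\<lparr>legs := ls\<rparr>) \<Longrightarrow> e ls = e' ls"
  shows "homotopy e (legs D) = homotopy e' (legs D)"
  by (rule combination_cong[OF combination_homotopy]) (use weil_diagram_lower(1)[OF assms(1)] assms(2) in blast)

lemma homotopy_diagram_iso: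
  assumes "isomorphic D D'"
  shows "homotopy_diagram D = homotopy_diagram D'"
proof -
  obtain \<phi> where D: "weil_diagram D" and \<phi>: "is_isomorphism \<phi> D D'"
    using assms by (auto simp: isomorphic_def)
  show ?thesis
    unfolding homotopy_diagram_def is_isomorphismD(4)[OF \<phi>] homotopy_map
    by (rule homotopy_diagram_cong[OF D]) (rule diagram_vec_eq[OF isomorphic_legs[OF _ \<phi>]])
qed

lift_definition homotopy_class :: "diagram_class \<Rightarrow> diagram_comb" is homotopy_diagram
  by (rule homotopy_diagram_iso)

lemma homotopy_class_of_diagram: "weil_diagram D \<Longrightarrow> homotopy_class (iso_class D) = homotopy_diagram D"
  by (simp add: homotopy_class.abs_eq isomorphic_refl)

text \<open>The homotopy changes only the legs and the relations only \<open>rot\<close>, so a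
  relator goes to a combination of relators with the same \<open>rs\<close>.\<close>

lemma homotopy_rot_relator:
  assumes D: "weil_diagram D" and rs: "rot_relation D rs"
  shows "linear_extension homotopy_class (rot_relator D rs) \<in> tilde_relations"
proof -
  have "(\<Sum>r\<leftarrow>rs. homotopy (e r) xs) = homotopy (\<lambda>ls. \<Sum>r\<leftarrow>rs. e r ls) xs"
    for e :: "(nat \<Rightarrow> nat) \<Rightarrow> leg list \<Rightarrow> diagram_comb" and xs
    by (induction rs) (simp_all add: combination_linear[OF combination_homotopy])
  moreover have "linear_extension homotopy_class (rot_relator D rs) = (\<Sum>r\<leftarrow>rs. homotopy_diagram (D\<lparr>rot := r\<rparr>))"
    by (rule linear_extension_rot_relator[OF D rs]) (rule homotopy_class_of_diagram)
  ultimately have "linear_extension homotopy_class (rot_relator D rs) = homotopy (\<lambda>ls. rot_relator (D\<lparr>legs := ls\<rparr>) rs) (legs D)"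
    by (simp add: homotopy_diagram_def rot_relator_def rot_legs_update)
  also have "\<dots> \<in> tilde_relations"
    by (rule combination_closed[OF combination_homotopy])
      (use rot_relator_in_relations[OF weil_diagram_lower(1)[OF D] rot_relation_legs(1)[OF rs]] in auto)
  finally show ?thesis .
qed

section \<open>The homotopy identities for single diagrams\<close>

lemma differential_sum:
  "(\<Sum>k<length (legs D). if snd (legs D ! k) = 1
      then comb_scale (prefix_sign D k) (F ((legs D)[k := (fst (legs D ! k), 2)])) else 0) =
    leg_op d_rule (\<lambda>_. F) (legs D)"
  unfolding leg_op_conv_sum
  by (rule sum.cong)
    (auto simp: d_rule_def prefix_sign_def signed_def take_map upd_conv_take_nth_drop)

text \<open>\<open>iota_leg\<close> without its effect on the list of legs.\<close>

definition iota_base :: "diagram \<Rightarrow> leg \<Rightarrow> diagram" where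
  "iota_base D z =
     (let h = fst z; m = fresh_half_edge D in
      if snd z = 1 then D\<lparr>special := Some h\<rparr>
      else D\<lparr>half_edges := half_edges D \<union> {m, m + 1, m + 2, m + 3},
             edge := (edge D)(m := m + 1, m + 1 := m, m + 2 := m + 3, m + 3 := m + 2),
             rot := (rot D)(h := m, m := m + 2, m + 2 := h, m + 1 := m + 1, m + 3 := m + 3),
             special := Some (m + 1)\<rparr>)"

text \<open>\<open>F\<close> is \<open>diagram_vec\<close> for \<iota> alone and
  \<open>homotopy_diagram\<close> for \<iota> followed by the homotopy. The half-edge of the new leg
  is the fresh one plus 3.\<close>

lemma iota_sum:
  assumes "weil_diagram D"
  shows "(\<Sum>k<length (legs D). comb_scale (prefix_sign D k) (F (iota_leg D k))) =
    leg_op (iota_rule (fresh_half_edge D + 3)) (\<lambda>z ls. F ((iota_base D z)\<lparr>legs := ls\<rparr>)) (legs D)"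
  unfolding leg_op_conv_sum
proof (rule sum.cong[OF refl])
  fix k
  assume "k \<in> {..<length (legs D)}"
  then have k: "k < length (legs D)"
    by simp
  obtain w where w: "iota_rule (fresh_half_edge D + 3) (legs D ! k) = Some w"
    and "iota_leg D k = (iota_base D (legs D ! k))\<lparr>legs := take k (legs D) @ w @ drop (Suc k) (legs D)\<rparr>"
    using weil_diagram_legD(3)[OF assms k] k
    by (elim disjE)
      (simp_all add: iota_rule_def iota_base_def iota_leg_def Let_def upd_conv_take_nth_drop)
  then show "comb_scale (prefix_sign D k) (F (iota_leg D k)) = signed (word_grade (take k (legs D)))
      (case iota_rule (fresh_half_edge D + 3) (legs D ! k) of None \<Rightarrow> 0
       | Some w \<Rightarrow> F ((iota_base D (legs D ! k))\<lparr>legs := take k (legs D) @ w @ drop (Suc k) (legs D)\<rparr>))"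
    by (simp add: prefix_sign_def signed_def take_map)
qed

lemma d_homotopy_diagram:
  assumes D: "weil_diagram D"
  shows "linear_extension differential_class (homotopy_diagram D) +
      linear_extension homotopy_class (differential_diagram D) = diagram_vec D - average_diagram D"
proof -
  let ?e = "\<lambda>ls. diagram_vec (D\<lparr>legs := ls\<rparr>)"
  have "linear_extension differential_class (homotopy_diagram D) =
      homotopy (\<lambda>ls. linear_extension differential_class (?e ls)) (legs D)"
    unfolding homotopy_diagram_def by (rule combination_linear_extension[OF combination_homotopy])
  also have "\<dots> = homotopy (leg_op d_rule (\<lambda>_. ?e)) (legs D)"
  proof (rule homotopy_diagram_cong[OF D])
    fix ls
    assume "weil_diagram (D\<lparr>legs := ls\<rparr>)"
    then show "linear_extension differential_class (?e ls) = leg_op d_rule (\<lambda>_. ?e) ls"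
      using differential_sum[of "D\<lparr>legs := ls\<rparr>" ?e]
      by (simp add: linear_extension_vec class_of_diagram differential_diagram_def cong: if_cong)
  qed
  finally have 1: "linear_extension differential_class (homotopy_diagram D) =
      homotopy (leg_op d_rule (\<lambda>_. ?e)) (legs D)" .
  have "linear_extension homotopy_class (differential_diagram D) =
      (\<Sum>k<length (legs D). if snd (legs D ! k) = 1
        then comb_scale (prefix_sign D k) (homotopy ?e ((legs D)[k := (fst (legs D ! k), 2)])) else 0)"
    unfolding differential_diagram_def linear_extension_sum
  proof (rule sum.cong[OF refl])
    fix k
    assume "k \<in> {..<length (legs D)}"
    then have w: "weil_diagram (D\<lparr>legs := (legs D)[k := (fst (legs D ! k), 2)]\<rparr>)"
      by (intro weil_diagram_regrade[OF D]) simp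
    have "linear_extension homotopy_class 0 = 0"
      by (simp add: linear_extension_def)
    then show "linear_extension homotopy_class (if snd (legs D ! k) = 1
        then comb_scale (prefix_sign D k) (diagram_vec (D\<lparr>legs := (legs D)[k := (fst (legs D ! k), 2)]\<rparr>)) else 0) =
      (if snd (legs D ! k) = 1
        then comb_scale (prefix_sign D k) (homotopy ?e ((legs D)[k := (fst (legs D ! k), 2)])) else 0)"
      by (simp add: linear_extension_scale linear_extension_vec homotopy_class_of_diagram[OF w] homotopy_diagram_def)
  qed
  then have 2: "linear_extension homotopy_class (differential_diagram D) = leg_op d_rule (\<lambda>_. homotopy ?e) (legs D)"
    by (simp only: differential_sum)
  show ?thesis
    using d_homotopy[OF weil_diagramD(8)[OF D], of ?e]
    by (simp add: 1 2 average_diagram_conv_symmetrize add.commute)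
qed

lemma iota_homotopy_diagram:
  assumes D: "weil_diagram D" and s: "special D = None"
  shows "linear_extension homotopy_class (iota_diagram D) +
      linear_extension iota_class (homotopy_diagram D) = 0"
proof -
  define E where "E = (\<lambda>z ls. diagram_vec ((iota_base D z)\<lparr>legs := ls\<rparr>))"
  define r where "r = iota_rule (fresh_half_edge D + 3)"
  have "linear_extension iota_class (homotopy_diagram D) =
      homotopy (\<lambda>ls. linear_extension iota_class (diagram_vec (D\<lparr>legs := ls\<rparr>))) (legs D)"
    unfolding homotopy_diagram_def by (rule combination_linear_extension[OF combination_homotopy])
  also have "\<dots> = homotopy (leg_op r E) (legs D)"
  proof (rule homotopy_diagram_cong[OF D])
    fix ls
    assume w: "weil_diagram (D\<lparr>legs := ls\<rparr>)"
    \<comment> \<open>Fresh half-edges do not depend on the legs, so both orders of \<iota> and the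
      homotopy adjoin the same ones.\<close>
    have "fresh_half_edge (D\<lparr>legs := ls\<rparr>) = fresh_half_edge D"
      by (simp add: fresh_half_edge_def)
    moreover from this have "(iota_base (D\<lparr>legs := ls\<rparr>) z)\<lparr>legs := ls'\<rparr> = (iota_base D z)\<lparr>legs := ls'\<rparr>" for z ls'
      by (simp add: iota_base_def Let_def)
    ultimately show "linear_extension iota_class (diagram_vec (D\<lparr>legs := ls\<rparr>)) = leg_op r E ls"
      using iota_sum[OF w, of diagram_vec] s w
      by (simp add: linear_extension_vec class_of_diagram iota_diagram_def r_def E_def)
  qed
  finally have 1: "linear_extension iota_class (homotopy_diagram D) = homotopy (leg_op r E) (legs D)" .
  have "linear_extension homotopy_class (iota_diagram D) =
      (\<Sum>k<length (legs D). comb_scale (prefix_sign D k) (homotopy_diagram (iota_leg D k)))"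
    using s weil_diagram_iota_leg[OF D s]
    by (simp add: iota_diagram_def linear_extension_sum linear_extension_scale linear_extension_vec
        homotopy_class_of_diagram)
  also have "\<dots> = leg_op r (\<lambda>z. homotopy (E z)) (legs D)"
    unfolding iota_sum[OF D, of homotopy_diagram] r_def E_def by (simp add: homotopy_diagram_def)
  finally show ?thesis
    using iota_homotopy[of _ E "legs D"] by (simp add: 1 r_def)
qed

section \<open>The homotopy on the quotient\<close>

lift_definition tilde_homotopy :: "weil_tilde \<Rightarrow> weil_tilde" is "linear_extension homotopy_class"
  by (rule operator_respects_tilde_relations[OF homotopy_rot_relator])

text \<open>\<open>P\<close> is to be the absence or the presence of a special vertex, which a
  change of legs does not affect.\<close>

lemma tilde_homotopy_grades:
  assumes P: "\<And>D ls. P (D\<lparr>legs := ls\<rparr>) \<longleftrightarrow> P (D :: diagram)"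
    and v: "v \<in> comb.span {diagram_vec D | D. weil_diagram D \<and> P D \<and> int (leg_grade D) = i}"
  shows "linear_extension homotopy_class v \<in>
    comb.span {diagram_vec D | D. weil_diagram D \<and> P D \<and> int (leg_grade D) = i - 1}"
proof (rule linear_extension_span[OF _ comb.subspace_span v], clarify)
  fix D
  assume D: "weil_diagram D" "P D" "i = int (leg_grade D)"
  show "linear_extension homotopy_class (diagram_vec D) \<in>
      comb.span {diagram_vec E | E. weil_diagram E \<and> P E \<and> int (leg_grade E) = int (leg_grade D) - 1}"
    unfolding linear_extension_vec homotopy_class_of_diagram[OF D(1)] homotopy_diagram_def
  proof (rule combination_closed[OF combination_homotopy comb.subspace_span])
    fix ls
    assume "ls \<in> {ls. \<exists>x\<in>#mset (legs D). snd x = 2 \<and> add_mset x (mset ls) = add_mset (lower x) (mset (legs D))}"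
    then have "weil_diagram (D\<lparr>legs := ls\<rparr>)" "Suc (word_grade ls) = leg_grade D"
      using weil_diagram_lower[OF D(1)] by blast+
    moreover from this have "int (leg_grade (D\<lparr>legs := ls\<rparr>)) = int (leg_grade D) - 1"
      by (simp add: leg_grade_def)
    ultimately show "diagram_vec (D\<lparr>legs := ls\<rparr>) \<in>
        comb.span {diagram_vec E | E. weil_diagram E \<and> P E \<and> int (leg_grade E) = int (leg_grade D) - 1}"
      using D(2) P[of ls D] by (intro comb.span_base) blast
  qed
qed

lemma linear_between_tilde_homotopy:
  "linear_between (tilde_grade i) (tilde_grade (i - 1)) tilde_homotopy"
  "linear_between (tilde_iota_grade i) (tilde_iota_grade (i - 1)) tilde_homotopy"
proof -
  have "tilde_homotopy (x + y) = tilde_homotopy x + tilde_homotopy y" for x y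
    by transfer (simp add: linear_extension_add)
  moreover have "tilde_homotopy (tilde_scale c x) = tilde_scale c (tilde_homotopy x)" for c x
    by transfer (simp add: linear_extension_scale)
  ultimately show "linear_between (tilde_grade i) (tilde_grade (i - 1)) tilde_homotopy"
    "linear_between (tilde_iota_grade i) (tilde_iota_grade (i - 1)) tilde_homotopy"
    using tilde_homotopy_grades[of "\<lambda>D. special D = None" _ i] tilde_homotopy_grades[of "\<lambda>D. special D \<noteq> None" _ i]
    by (auto simp: linear_between_def tilde_grade_def tilde_iota_grade_def tilde_homotopy.abs_eq)
qed

text \<open>Covers both identities: \<open>c = 1\<close> with \<open>k\<close> the averaging for
  \<open>d\<close>, and \<open>c = 0\<close> with \<open>k\<close> zero for \<iota>.\<close>

lemma linear_extension_eqI: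
  assumes "v \<in> comb.span B"
    and "\<And>x. x \<in> B \<Longrightarrow> linear_extension f (linear_extension g x) + linear_extension f' (linear_extension g' x) =
      comb_scale c x - linear_extension k x"
  shows "linear_extension f (linear_extension g v) + linear_extension f' (linear_extension g' v) =
      comb_scale c v - linear_extension k v"
  using assms(1)
proof (induction rule: comb.span_induct_alt)
  case base
  have "linear_extension g 0 = 0" for g
    by (simp add: linear_extension_def)
  then show ?case
    by simp
next
  case (step a x y)
  have "linear_extension f (linear_extension g (comb_scale a x + y)) +
      linear_extension f' (linear_extension g' (comb_scale a x + y)) =
    comb_scale a (linear_extension f (linear_extension g x) + linear_extension f' (linear_extension g' x)) +
    (linear_extension f (linear_extension g y) + linear_extension f' (linear_extension g' y))"
    by (simp add: linear_extension_add linear_extension_scale comb.scale_right_distrib)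
  also have "\<dots> = comb_scale c (comb_scale a x + y) - linear_extension k (comb_scale a x + y)"
    unfolding step.IH assms(2)[OF step.hyps(1)]
    by (simp add: linear_extension_add linear_extension_scale comb.scale_right_distrib
        comb.scale_right_diff_distrib mult.commute)
  finally show ?case .
qed

lemma tilde_d_homotopy:
  assumes "v \<in> comb.span {diagram_vec D | D. weil_diagram D}"
  shows "tilde_d (tilde_homotopy (abs_weil_tilde v)) + tilde_homotopy (tilde_d (abs_weil_tilde v)) =
    abs_weil_tilde v - chi (tau (abs_weil_tilde v))"
proof -
  have "linear_extension differential_class (linear_extension homotopy_class v) +
      linear_extension homotopy_class (linear_extension differential_class v) =
    comb_scale 1 v - linear_extension average_class v"
    using assms
    by (rule linear_extension_eqI)
      (auto simp: linear_extension_vec homotopy_class_of_diagram class_of_diagram d_homotopy_diagram)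
  then show ?thesis
    by (simp add: tilde_homotopy.abs_eq tilde_d.abs_eq chi.abs_eq tau.abs_eq plus_weil_tilde.abs_eq
        minus_weil_tilde.abs_eq)
qed

theorem theorem5p0p4:
  "\<exists>(s :: int \<Rightarrow> weil_tilde \<Rightarrow> weil_tilde) (s_iota :: int \<Rightarrow> weil_tilde \<Rightarrow> weil_tilde).
     \<forall>i.
       linear_between (tilde_grade i) (tilde_grade (i - 1)) (s i) \<and>
       linear_between (tilde_iota_grade i) (tilde_iota_grade (i - 1)) (s_iota i) \<and>
       (\<forall>x\<in>tilde_grade i. tilde_d (s i x) + s (i + 1) (tilde_d x) = x - chi (tau x)) \<and>
       (\<forall>x\<in>tilde_iota_grade i.
          tilde_d (s_iota i x) + s_iota (i + 1) (tilde_d x) = x - chi (tau x)) \<and>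
       (\<forall>x\<in>tilde_grade i. s_iota (i - 1) (tilde_iota x) + tilde_iota (s i x) = 0)"
proof (intro exI allI conjI ballI)
  fix i x
  \<comment> \<open>Both families are constant with value \<open>tilde_homotopy\<close>, an operator
    on the whole direct sum given by one formula for all leg-grades, with or without a special
    vertex.\<close>
  show "linear_between (tilde_grade i) (tilde_grade (i - 1)) tilde_homotopy"
    "linear_between (tilde_iota_grade i) (tilde_iota_grade (i - 1)) tilde_homotopy"
    by (fact linear_between_tilde_homotopy)+
  have sub: "comb.span {diagram_vec D | D. weil_diagram D \<and> Q D} \<subseteq> comb.span {diagram_vec D | D. weil_diagram D}" for Q
    by (rule comb.span_mono) blast
  show "tilde_d (tilde_homotopy x) + tilde_homotopy (tilde_d x) = x - chi (tau x)" if "x \<in> tilde_grade i"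
    using that unfolding tilde_grade_def
    by (elim imageE, hypsubst) (erule tilde_d_homotopy[OF subsetD[OF sub]])
  show "tilde_d (tilde_homotopy x) + tilde_homotopy (tilde_d x) = x - chi (tau x)" if "x \<in> tilde_iota_grade i"
    using that unfolding tilde_iota_grade_def
    by (elim imageE, hypsubst) (erule tilde_d_homotopy[OF subsetD[OF sub]])
  show "tilde_homotopy (tilde_iota x) + tilde_iota (tilde_homotopy x) = 0" if x: "x \<in> tilde_grade i"
  proof -
    obtain v where v: "v \<in> comb.span {diagram_vec D | D. weil_diagram D \<and> special D = None \<and> int (leg_grade D) = i}"
      "x = abs_weil_tilde v"
      using x unfolding tilde_grade_def by blast
    have "linear_extension homotopy_class (linear_extension iota_class v) +
        linear_extension iota_class (linear_extension homotopy_class v) =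
      comb_scale 0 v - linear_extension (\<lambda>_. 0) v"
      using v(1)
      by (rule linear_extension_eqI)
        (auto simp: linear_extension_vec homotopy_class_of_diagram class_of_diagram iota_homotopy_diagram)
    moreover have "linear_extension (\<lambda>_. 0) v = 0"
      by (simp add: linear_extension_def)
    ultimately show ?thesis
      by (simp add: v(2) tilde_homotopy.abs_eq tilde_iota.abs_eq plus_weil_tilde.abs_eq zero_weil_tilde.abs_eq)
  qed
qed

end
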